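(* For every $n\in\mathbb N$, every origin-symmetric convex sets $K,L\subseteq\mathbb R^n$ and every $\lambda\in(0,1)$, $$\gamma_n\big(\lambda K+(1-\lambda)L\big)^{\frac{1}{n}} \geq \lambda\, \gamma_n(K)^{\frac{1}{n}}+(1-\lambda)\,\gamma_n(L)^{\frac{1}{n}}.$$
   Context: $\gamma_n$ denotes the standard Gaussian measure on $\mathbb R^n$, $\mathrm{d}\gamma_n(x)=(2\pi)^{-n/2}e^{-|x|^2/2}\,\mathrm{d}x$, where $|x|$ is the Euclidean norm. A set $K$ is (origin-)symmetric if $K=-K$. The Minkowski combination is $\lambda K+(1-\lambda)L=\{\lambda a+(1-\lambda)b:\ a\in K,\ b\in L\}$.
   Formalization: The sets K and L are assumed nonempty; with K empty and L of positive Gaussian measure the left side is 0 and the right side is positive, so the inequality as written fails. *)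

theory Defs
  imports "HOL-Analysis.Analysis"
begin

text \<open>Standard Gaussian measure on R^n, with R^n modelled as real^'n (n = CARD('n)).
  It is built on the Lebesgue (completed) measure, since convex sets are
  Lebesgue measurable but need not be Borel.\<close>
definition gaussian_measure :: "('n::finite) itself \<Rightarrow> (real^'n) measure" where
  "gaussian_measure _ = density lebesgue
     (\<lambda>x::real^'n. ennreal ((2 * pi) powr (- real CARD('n) / 2) * exp (- (norm x)\<^sup>2 / 2)))"

definition minkowski_comb :: "real \<Rightarrow> (real^'n) set \<Rightarrow> (real^'n) set \<Rightarrow> (real^'n) set" where
  "minkowski_comb t K L = {t *\<^sub>R a + (1 - t) *\<^sub>R b | a b. a \<in> K \<and> b \<in> L}"

definition origin_symmetric :: "(real^'n) set \<Rightarrow> bool" where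
  "origin_symmetric K \<longleftrightarrow> uminus ` K = K"

end

theory Submission
  imports Defs
begin

text \<open>Let \<open>C\<close> be symmetric, bounded and contain \<open>((1 + a) A + (1 - a) B) / 2\<close>. Writing
  \<open>x = (1 + a) u + (1 - a) w\<close> and \<open>y = (1 - a) u - (1 + a) w\<close> turns the Gaussian weight on \<open>A \<times> B\<close> into
  one on \<open>(u, w)\<close>, and for fixed \<open>u\<close> the Prekopa-Leindler inequality replaces the fibre \<open>E\<close> in \<open>w\<close>
  by \<open>(E - E) / 2\<close>. For \<open>w\<close> in the latter both points \<open>p, q = (1 + a^2) u \<plusminus> (1 - a^2) w\<close> lie in \<open>C\<close>. In the
  coordinates \<open>p, q\<close> the weight is the standard one times
  \<open>exp (- k (|p|^2 + |q|^2) + d p \<bullet> q)\<close> with \<open>k\<close> of order \<open>a^2\<close> and \<open>d = O(a^2)\<close>. Averaging over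
  \<open>p \<mapsto> - p\<close> turns the cross term into \<open>cosh (d p \<bullet> q) \<le> exp (d^2 (p \<bullet> q)^2 / 2)\<close>, which is of order
  \<open>a^4\<close> and thus absorbed for small \<open>a\<close>. Hence \<open>(1 - a^2)^n \<gamma>(A) \<gamma>(B) \<le> \<gamma>(C)^2\<close>.

  If the claim failed, the quotient of \<open>\<gamma>(t K + (1 - t) L)\<close> by the \<open>n\<close>-th power of the affine
  interpolation \<open>l\<close> of the end values would have a first interior minimum \<open>t0\<close>. Taking \<open>A\<close>, \<open>B\<close>
  at \<open>t0 + s / (1 + a)\<close> and \<open>t0 - s / (1 - a)\<close> with \<open>a\<close> proportional to \<open>s\<close> such that
  \<open>(1 - a^2) l(t+) l(t-) = l(t0)^2\<close> contradicts the inequality above.\<close>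

section \<open>The Prekopa-Leindler inequality\<close>

text \<open>One-dimensional Brunn-Minkowski: cut \<open>A\<close> off above \<open>x\<close> and
  \<open>B\<close> off below \<open>y\<close>; the halved translates \<open>P\<close> by
  \<open>y\<close> and \<open>Q\<close> by \<open>x\<close> have all points but \<open>m\<close> of
  \<open>Q\<close> in \<open>C\<close>, and they meet at most in \<open>m\<close>. Since extrema
  need not be attained, \<open>x\<close> and \<open>y\<close> are only nearly extremal, which costs
  \<open>e / 2\<close> per set. A given measurable \<open>C\<close> avoids measurability questions
  about the set of midpoints.\<close>

lemma midpoint_sum_bounded:
  fixes A B C :: "real set"
  assumes [measurable]: "A \<in> sets borel" "B \<in> sets borel" "C \<in> sets borel"
    and ne: "A \<noteq> {}" "B \<noteq> {}" and bdd: "bdd_above A" "bdd_below B"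
    and mid: "\<And>x y. x \<in> A \<Longrightarrow> y \<in> B \<Longrightarrow> (x + y) / 2 \<in> C"
  shows "emeasure lborel A + emeasure lborel B \<le> 2 * emeasure lborel C"
proof (rule ennreal_le_epsilon)
  fix e :: real assume e: "0 < e"
  obtain x where x: "x \<in> A" "Sup A - e / 2 < x"
    using less_cSup_iff[OF ne(1) bdd(1), of "Sup A - e/2"] e by auto
  obtain y where y: "y \<in> B" "y < Inf B + e / 2"
    using cInf_less_iff[OF ne(2) bdd(2), of "Inf B + e/2"] e by auto
  define A1 where "A1 = A \<inter> {..x}"
  define B1 where "B1 = B \<inter> {y..}"
  have [measurable]: "A1 \<in> sets borel" "B1 \<in> sets borel"
    by (auto simp: A1_def B1_def)
  have "A \<subseteq> A1 \<union> {x..Sup A}"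
    using cSup_upper[OF _ bdd(1)] by (auto simp: A1_def)
  then have "emeasure lborel A \<le> emeasure lborel (A1 \<union> {x..Sup A})"
    by (intro emeasure_mono) auto
  also have "\<dots> \<le> emeasure lborel A1 + emeasure lborel {x..Sup A}"
    by (intro emeasure_subadditive) auto
  also have "emeasure lborel {x..Sup A} \<le> ennreal (e / 2)"
    using x cSup_upper[OF x(1) bdd(1)] by (auto intro!: ennreal_leI)
  finally have 1: "emeasure lborel A \<le> emeasure lborel A1 + ennreal (e / 2)" by (simp add: add_left_mono)
  have "B \<subseteq> B1 \<union> {Inf B..y}"
    using cInf_lower[OF _ bdd(2)] by (auto simp: B1_def)
  then have "emeasure lborel B \<le> emeasure lborel (B1 \<union> {Inf B..y})"
    by (intro emeasure_mono) auto
  also have "\<dots> \<le> emeasure lborel B1 + emeasure lborel {Inf B..y}"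
    by (intro emeasure_subadditive) auto
  also have "emeasure lborel {Inf B..y} \<le> ennreal (e / 2)"
    using y cInf_lower[OF y(1) bdd(2)] by (auto intro!: ennreal_leI)
  finally have 2: "emeasure lborel B \<le> emeasure lborel B1 + ennreal (e / 2)" by (simp add: add_left_mono)
  define P where "P = {z. -y + 2 * z \<in> A1}"
  define Q where "Q = {z. -x + 2 * z \<in> B1}"
  have [measurable]: "P \<in> sets borel" "Q \<in> sets borel"
    unfolding P_def Q_def by measurable
  have scale: "emeasure lborel S = 2 * emeasure lborel {z. c + 2 * z \<in> S}"
    if [measurable]: "S \<in> sets borel" for S and c :: real
  proof -
    have "emeasure lborel S = (\<integral>\<^sup>+z. indicator S z \<partial>lborel)" by simp
    also have "\<dots> = 2 * (\<integral>\<^sup>+z. indicator S (c + 2 * z) \<partial>lborel)"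
      by (subst nn_integral_real_affine[where c = 2 and t = c]) auto
    also have "(\<integral>\<^sup>+z. indicator S (c + 2 * z) \<partial>lborel) = (\<integral>\<^sup>+z. indicator {z. c + 2 * z \<in> S} z \<partial>lborel)"
      by (simp add: indicator_def)
    finally show ?thesis by simp
  qed
  define m where "m = (x + y) / 2"
  have sub: "P \<union> (Q - {m}) \<subseteq> C"
  proof
    fix z assume "z \<in> P \<union> (Q - {m})"
    then show "z \<in> C"
      using mid[of "-y + 2 * z" y] mid[of x "-x + 2 * z"] x(1) y(1)
      by (auto simp: P_def Q_def A1_def B1_def)
  qed
  have disj: "P \<inter> (Q - {m}) = {}"
    by (auto simp: P_def Q_def A1_def B1_def m_def)
  have "emeasure lborel P + emeasure lborel Q = emeasure lborel P + emeasure lborel (Q - {m})"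
    by (subst emeasure_Diff_null_set) auto
  also have "\<dots> = emeasure lborel (P \<union> (Q - {m}))"
    by (rule plus_emeasure) (use disj in auto)
  also have "\<dots> \<le> emeasure lborel C"
    using sub by (intro emeasure_mono) auto
  finally have "2 * (emeasure lborel P + emeasure lborel Q) \<le> 2 * emeasure lborel C"
    by (rule mult_left_mono) simp
  then have 3: "emeasure lborel A1 + emeasure lborel B1 \<le> 2 * emeasure lborel C"
    using scale[of A1 "-y"] scale[of B1 "-x"] by (simp add: P_def Q_def distrib_left)
  have "emeasure lborel A + emeasure lborel B
     \<le> (emeasure lborel A1 + emeasure lborel B1) + (ennreal (e/2) + ennreal (e/2))"
    using add_mono[OF 1 2] by (simp add: ac_simps)
  also have "ennreal (e/2) + ennreal (e/2) = ennreal e"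
    using e by (subst ennreal_plus[symmetric]) auto
  finally show "emeasure lborel A + emeasure lborel B \<le> 2 * emeasure lborel C + ennreal e"
    using 3 by (meson add_right_mono order_trans)
qed

text \<open>Exhaust \<open>A\<close> by sets bounded above and \<open>B\<close> by sets bounded
  below and use continuity of the measure from below.\<close>

lemma midpoint_sum:
  fixes A B C :: "real set"
  assumes [measurable]: "A \<in> sets borel" "B \<in> sets borel" "C \<in> sets borel"
    and ne: "A \<noteq> {}" "B \<noteq> {}"
    and mid: "\<And>x y. x \<in> A \<Longrightarrow> y \<in> B \<Longrightarrow> (x + y) / 2 \<in> C"
  shows "emeasure lborel A + emeasure lborel B \<le> 2 * emeasure lborel C"
proof -
  obtain x y where xy: "x \<in> A" "y \<in> B" using ne by auto
  define F where "F k = A \<inter> {..real k}" for k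
  define H where "H k = B \<inter> {- real k..}" for k
  have UF: "(\<Union>k. F k) = A" "(\<Union>k. H k) = B"
    using real_arch_simple by (auto simp: F_def H_def) (metis minus_le_iff real_arch_simple)
  have "(\<lambda>k. emeasure lborel (F k)) \<longlonglongrightarrow> emeasure lborel (\<Union>k. F k)"
    by (rule Lim_emeasure_incseq) (auto simp: F_def incseq_def)
  moreover have "(\<lambda>k. emeasure lborel (H k)) \<longlonglongrightarrow> emeasure lborel (\<Union>k. H k)"
    by (rule Lim_emeasure_incseq) (auto simp: H_def incseq_def)
  ultimately have lim: "(\<lambda>k. emeasure lborel (F k) + emeasure lborel (H k)) \<longlonglongrightarrow> emeasure lborel A + emeasure lborel B"
    unfolding UF by (intro tendsto_add) auto
  \<comment> \<open>From \<open>N\<close> on the truncations contain \<open>x\<close> and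
    \<open>y\<close>, hence are nonempty.\<close>
  obtain N where N: "real N \<ge> max x (-y)" using real_arch_simple by blast
  show ?thesis
  proof (rule LIMSEQ_le_const2[OF lim], intro exI allI impI)
    fix k assume k: "N \<le> k"
    then have "real N \<le> real k" by simp
    show "emeasure lborel (F k) + emeasure lborel (H k) \<le> 2 * emeasure lborel C"
    proof (rule midpoint_sum_bounded)
      show "F k \<noteq> {}" "H k \<noteq> {}"
        using xy N \<open>real N \<le> real k\<close> by (auto simp: F_def H_def)
      show "bdd_above (F k)" "bdd_below (H k)"
        unfolding F_def H_def bdd_above_def bdd_below_def by auto
    qed (auto simp: F_def H_def intro: mid)
  qed
qed

text \<open>Each value \<open>f x\<close> is the length of the set of levels \<open>s\<close> with
  \<open>0 < s < f x\<close>; Tonelli swaps the two integrals. The indicator is essential because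
  \<open>ennreal s\<close> is 0 for every negative \<open>s\<close>.\<close>

lemma layer_cake:
  fixes f :: "real \<Rightarrow> ennreal"
  assumes [measurable]: "f \<in> borel_measurable borel"
  shows "(\<integral>\<^sup>+x. f x \<partial>lborel) = (\<integral>\<^sup>+s. indicator {0<..} s * emeasure lborel {x. ennreal s < f x} \<partial>lborel)"
proof -
  have inf: "emeasure lborel {0::real<..} = top"
  proof -
    have "of_nat n \<le> emeasure lborel {0::real<..}" for n
    proof -
      have "ennreal (real n) = emeasure lborel {0<..<real n}" by simp
      also have "\<dots> \<le> emeasure lborel {0::real<..}" by (intro emeasure_mono) auto
      finally show ?thesis by (simp add: ennreal_of_nat_eq_real_of_nat)
    qed
    then have "(SUP n. of_nat n) \<le> emeasure lborel {0::real<..}" by (intro SUP_least)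
    then show ?thesis by (simp add: ennreal_SUP_of_nat_eq_top top.extremum_unique)
  qed
  have *: "f x = (\<integral>\<^sup>+s. indicator {0<..} s * indicator {x. ennreal s < f x} x \<partial>lborel)" for x
  proof (cases "f x")
    case (real r)
    have "(\<integral>\<^sup>+s. indicator {0<..} s * indicator {x. ennreal s < f x} x \<partial>lborel) = (\<integral>\<^sup>+s. indicator {0<..<r} s \<partial>lborel)"
      by (intro nn_integral_cong) (auto simp: indicator_def real ennreal_less_iff)
    then show ?thesis using real by simp
  next
    case top
    have "(\<integral>\<^sup>+s. indicator {0<..} s * indicator {x. ennreal s < f x} x \<partial>lborel) = (\<integral>\<^sup>+s. indicator {0::real<..} s \<partial>lborel)"
      by (intro nn_integral_cong) (auto simp: indicator_def top)
    then show ?thesis using top inf by simp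
  qed
  have "(\<integral>\<^sup>+x. f x \<partial>lborel) = (\<integral>\<^sup>+x. \<integral>\<^sup>+s. indicator {0<..} s * indicator {x. ennreal s < f x} x \<partial>lborel \<partial>lborel)"
    by (subst *) simp
  also have "\<dots> = (\<integral>\<^sup>+s. \<integral>\<^sup>+x. indicator {0<..} s * indicator {x. ennreal s < f x} x \<partial>lborel \<partial>lborel)"
    by (rule lborel_pair.Fubini') measurable
  also have "\<dots> = (\<integral>\<^sup>+s. indicator {0<..} s * emeasure lborel {x. ennreal s < f x} \<partial>lborel)"
    by (subst nn_integral_cmult) auto
  finally show ?thesis .
qed

text \<open>For \<open>0 < s < 1\<close> the superlevel sets of \<open>f\<close> and
  \<open>g\<close> are nonempty, because the suprema are 1, and their midpoints lie in the
  superlevel set of \<open>h\<close>. From level 1 on the sets on the left are empty. Integrating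
  over \<open>s\<close> gives an additive bound, which implies the product form by AM-GM.\<close>

lemma prekopa_leindler_normalized:
  fixes f g h :: "real \<Rightarrow> ennreal"
  assumes [measurable]: "f \<in> borel_measurable borel" "g \<in> borel_measurable borel" "h \<in> borel_measurable borel"
    and sup: "(SUP x. f x) = 1" "(SUP x. g x) = 1"
    and le: "\<And>x y. f x * g y \<le> (h ((x + y) / 2))\<^sup>2"
  shows "(\<integral>\<^sup>+x. f x \<partial>lborel) + (\<integral>\<^sup>+x. g x \<partial>lborel) \<le> 2 * (\<integral>\<^sup>+x. h x \<partial>lborel)"
proof -
  have f1: "f x \<le> 1" and g1: "g x \<le> 1" for x
    using sup by (metis SUP_upper UNIV_I)+
  have lev: "indicator {0<..} s * emeasure lborel {x. ennreal s < f x} + indicator {0<..} s * emeasure lborel {x. ennreal s < g x}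
      \<le> 2 * (indicator {0<..} s * emeasure lborel {x. ennreal s < h x})" for s
  proof (cases "0 < s \<and> s < 1")
    case True
    then have "ennreal s < 1" by (simp add: ennreal_less_one_iff)
    then obtain x y where "ennreal s < f x" "ennreal s < g y"
      using sup by (metis less_SUP_iff)
    have "emeasure lborel {x. ennreal s < f x} + emeasure lborel {x. ennreal s < g x} \<le> 2 * emeasure lborel {x. ennreal s < h x}"
    proof (rule midpoint_sum)
      show "{x. ennreal s < f x} \<noteq> {}" "{x. ennreal s < g x} \<noteq> {}"
        using \<open>ennreal s < f x\<close> \<open>ennreal s < g y\<close> by auto
      fix x y assume "x \<in> {x. ennreal s < f x}" "y \<in> {x. ennreal s < g x}"
      then have s: "ennreal s < f x" "ennreal s < g y" by auto
      obtain p q where pq: "f x = ennreal p" "0 \<le> p" "g y = ennreal q" "0 \<le> q"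
        using f1[of x] g1[of y] by (metis ennreal_cases ennreal_one_neq_top top.extremum_unique)
      then have sp: "s < p" "s < q" using s True by (auto simp: ennreal_less_iff)
      have "ennreal s < h ((x + y) / 2)"
      proof (rule ccontr)
        assume "\<not> ?thesis"
        then have "h ((x + y) / 2) \<le> ennreal s" by simp
        then have "(h ((x + y) / 2))\<^sup>2 \<le> (ennreal s)\<^sup>2" by (intro power_mono) auto
        with le[of x y] have "f x * g y \<le> (ennreal s)\<^sup>2" by (rule order_trans)
        then have "ennreal (p * q) \<le> ennreal (s * s)"
          using pq True by (simp add: ennreal_mult power2_eq_square)
        then have "p * q \<le> s * s" using True by (simp add: ennreal_le_iff)
        moreover have "s * s < p * q" using sp True by (intro mult_strict_mono) auto
        ultimately show False by simp
      qed
      then show "(x + y) / 2 \<in> {x. ennreal s < h x}" by simp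
    qed measurable
    then show ?thesis using True by simp
  next
    case False
    then consider "s \<le> 0" | "1 \<le> s" by linarith
    then show ?thesis
    proof cases
      case 2
      then have "1 \<le> ennreal s" by simp
      then have "{x. ennreal s < f x} = {}" "{x. ennreal s < g x} = {}"
        using f1 g1 by (auto simp: not_less intro: order_trans[of _ 1])
      then show ?thesis by simp
    qed simp
  qed
  show ?thesis
    unfolding layer_cake[OF assms(1)] layer_cake[OF assms(2)] layer_cake[OF assms(3)]
    by (subst nn_integral_cmult[symmetric], measurable, subst nn_integral_add[symmetric], measurable)
       (auto intro!: nn_integral_mono lev)
qed

lemma ennreal_four_mult_le: "4 * (X * Y) \<le> (X + Y)\<^sup>2" for X Y :: ennreal
proof (cases "X = top \<or> Y = top")
  case True then show ?thesis by (auto simp: power2_eq_square ennreal_top_mult)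
next
  case False
  then obtain x y where "X = ennreal x" "0 \<le> x" "Y = ennreal y" "0 \<le> y" by (metis ennreal_cases)
  moreover have "4 * (x * y) \<le> (x + y)\<^sup>2" using sum_squares_bound[of x y] by (simp add: power2_sum)
  ultimately show ?thesis
    by (simp add: ennreal_mult[symmetric] ennreal_plus[symmetric] ennreal_power ennreal_numeral[symmetric] ennreal_leI del: ennreal_plus ennreal_numeral)
qed

text \<open>Rescale to suprema 1, apply the additive form and AM-GM, and undo the scaling by
  homogeneity. A vanishing supremum makes the left side 0.\<close>

lemma prekopa_leindler_bounded:
  fixes f g h :: "real \<Rightarrow> ennreal"
  assumes [measurable]: "f \<in> borel_measurable borel" "g \<in> borel_measurable borel" "h \<in> borel_measurable borel"
    and fin: "(SUP x. f x) \<noteq> top" "(SUP x. g x) \<noteq> top"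
    and le: "\<And>x y. f x * g y \<le> (h ((x + y) / 2))\<^sup>2"
  shows "(\<integral>\<^sup>+x. f x \<partial>lborel) * (\<integral>\<^sup>+x. g x \<partial>lborel) \<le> (\<integral>\<^sup>+x. h x \<partial>lborel)\<^sup>2"
proof (cases "(SUP x. f x) = 0 \<or> (SUP x. g x) = 0")
  case True
  then have "(\<forall>x. f x = 0) \<or> (\<forall>x. g x = 0)"
    by (metis SUP_upper UNIV_I le_zero_eq)
  then show ?thesis by auto
next
  case False
  obtain a b where ab: "(SUP x. f x) = ennreal a" "(SUP x. g x) = ennreal b" "0 \<le> a" "0 \<le> b"
    using fin by (metis ennreal_cases)
  then have pos: "0 < a" "0 < b" using False by (auto simp: le_less)
  \<comment> \<open>The geometric mean, so that dividing \<open>f\<close>, \<open>g\<close>,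
    \<open>h\<close> by \<open>a\<close>, \<open>b\<close>, \<open>c\<close> preserves the pointwise
    hypothesis.\<close>
  define c where "c = sqrt (a * b)"
  have c: "0 < c" "c * c = a * b" using pos by (auto simp: c_def)
  let ?F = "\<integral>\<^sup>+x. f x \<partial>lborel" and ?G = "\<integral>\<^sup>+x. g x \<partial>lborel" and ?H = "\<integral>\<^sup>+x. h x \<partial>lborel"
  have main: "ennreal (1/a) * ?F + ennreal (1/b) * ?G \<le> 2 * (ennreal (1/c) * ?H)"
  proof (subst (1 2 3) nn_integral_cmult[symmetric], goal_cases)
    case 4
    show ?case
    proof (rule prekopa_leindler_normalized)
      show "(SUP x. ennreal (1/a) * f x) = 1" "(SUP x. ennreal (1/b) * g x) = 1"
        using pos by (auto simp: SUP_mult_left_ennreal[symmetric] ab ennreal_mult[symmetric])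
      fix x y
      have "ennreal (1/a) * f x * (ennreal (1/b) * g y) = ennreal (1/c) * ennreal (1/c) * (f x * g y)"
      proof -
        have "ennreal (1/a) * ennreal (1/b) = ennreal (1/c) * ennreal (1/c)"
          using pos c by (simp add: ennreal_mult[symmetric])
        then show ?thesis by (metis mult.assoc mult.commute)
      qed
      also have "\<dots> \<le> ennreal (1/c) * ennreal (1/c) * (h ((x + y) / 2))\<^sup>2"
        by (rule mult_left_mono[OF le]) simp
      finally show "ennreal (1/a) * f x * (ennreal (1/b) * g y) \<le> (ennreal (1/c) * h ((x + y) / 2))\<^sup>2"
        by (simp add: power2_eq_square ac_simps)
    qed measurable
  qed simp_all
  have "4 * ((ennreal (1/a) * ?F) * (ennreal (1/b) * ?G)) \<le> (ennreal (1/a) * ?F + ennreal (1/b) * ?G)\<^sup>2"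
    by (rule ennreal_four_mult_le)
  also have "\<dots> \<le> (2 * (ennreal (1/c) * ?H))\<^sup>2" by (intro power_mono main) simp
  finally have "4 * ((ennreal (1/a) * ?F) * (ennreal (1/b) * ?G)) \<le> 4 * (ennreal (1/c) * ?H)\<^sup>2"
    by (simp add: power_mult_distrib)
  then have "(ennreal (1/a) * ?F) * (ennreal (1/b) * ?G) \<le> (ennreal (1/c) * ?H)\<^sup>2"
    by (subst (asm) ennreal_mult_le_mult_iff) auto
  then have "ennreal (c * c) * ((ennreal (1/a) * ?F) * (ennreal (1/b) * ?G)) \<le> ennreal (c * c) * (ennreal (1/c) * ?H)\<^sup>2"
    by (rule mult_left_mono) simp
  moreover have "ennreal (c * c) * ((ennreal (1/a) * ?F) * (ennreal (1/b) * ?G)) = (ennreal (a * b) * (ennreal (1/a) * ennreal (1/b))) * (?F * ?G)"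
    unfolding c by (simp add: ac_simps)
  moreover have "ennreal (a * b) * (ennreal (1/a) * ennreal (1/b)) = 1"
    using pos by (simp add: ennreal_mult[symmetric])
  moreover have "ennreal (c * c) * (ennreal (1/c) * ?H)\<^sup>2 = (ennreal (c * c) * (ennreal (1/c) * ennreal (1/c))) * ?H\<^sup>2"
    by (simp add: power2_eq_square ac_simps)
  moreover have "ennreal (c * c) * (ennreal (1/c) * ennreal (1/c)) = 1"
    using c(1) by (simp add: ennreal_mult[symmetric])
  ultimately show ?thesis by simp
qed

lemma SUP_min_of_nat_ennreal: "(SUP k. min (x::ennreal) (of_nat k)) = x"
proof -
  have "(SUP k. min x (of_nat k)) = min x (SUP k. of_nat k)"
    by (simp add: inf_min[symmetric] inf_SUP)
  then show ?thesis by (simp add: ennreal_SUP_of_nat_eq_top)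
qed

text \<open>Truncation of \<open>f\<close> and \<open>g\<close> at height \<open>k\<close> makes the
  suprema finite; monotone convergence removes it again.\<close>

lemma prekopa_leindler_real:
  fixes f g h :: "real \<Rightarrow> ennreal"
  assumes [measurable]: "f \<in> borel_measurable borel" "g \<in> borel_measurable borel" "h \<in> borel_measurable borel"
    and le: "\<And>x y. f x * g y \<le> (h ((x + y) / 2))\<^sup>2"
  shows "(\<integral>\<^sup>+x. f x \<partial>lborel) * (\<integral>\<^sup>+x. g x \<partial>lborel) \<le> (\<integral>\<^sup>+x. h x \<partial>lborel)\<^sup>2"
proof -
  define T where "T f k = (\<integral>\<^sup>+x. min (f x) (of_nat k) \<partial>lborel)" for f :: "real \<Rightarrow> ennreal" and k :: nat
  have mm: "min x (of_nat m) \<le> of_nat n" if "m \<le> n" for x :: ennreal and m n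
    by (rule min.coboundedI2) (rule of_nat_mono[OF that])
  have inc: "incseq (T f)" if "f \<in> borel_measurable borel" for f
    unfolding T_def incseq_def by (auto intro!: nn_integral_mono simp: mm)
  have T: "(\<integral>\<^sup>+x. f x \<partial>lborel) = (SUP k. T f k)" if [measurable]: "f \<in> borel_measurable borel" for f
  proof -
    have "(\<integral>\<^sup>+x. f x \<partial>lborel) = (\<integral>\<^sup>+x. (SUP k. min (f x) (of_nat k)) \<partial>lborel)"
      by (simp add: SUP_min_of_nat_ennreal)
    also have "\<dots> = (SUP k. T f k)"
      unfolding T_def by (rule nn_integral_monotone_convergence_SUP)
        (auto simp: incseq_def le_fun_def mm)
    finally show ?thesis .
  qed
  have b: "T f k * T g k \<le> (\<integral>\<^sup>+x. h x \<partial>lborel)\<^sup>2" for k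
    unfolding T_def
  proof (rule prekopa_leindler_bounded)
    have "(SUP x. min (u x) (of_nat k)) \<le> of_nat k" for u :: "real \<Rightarrow> ennreal"
      by (rule SUP_least) simp
    then show "(SUP x. min (f x) (of_nat k)) \<noteq> top" "(SUP x. min (g x) (of_nat k)) \<noteq> top"
      by (metis ennreal_of_nat_neq_top top.extremum_unique)+
    show "min (f x) (of_nat k) * min (g y) (of_nat k) \<le> (h ((x + y) / 2))\<^sup>2" for x y
      by (rule order_trans[OF mult_mono le]) auto
  qed measurable
  \<comment> \<open>A product of two suprema has independent indices, so both are raised to
    \<open>max i j\<close>.\<close>
  have "T f i * T g j \<le> (\<integral>\<^sup>+x. h x \<partial>lborel)\<^sup>2" for i j
    by (rule order_trans[OF mult_mono b[of "max i j"]]) (auto intro!: incseqD[OF inc])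
  then have "(SUP k. T f k) * (SUP k. T g k) \<le> (\<integral>\<^sup>+x. h x \<partial>lborel)\<^sup>2"
    by (auto simp: SUP_mult_left_ennreal SUP_mult_right_ennreal intro!: SUP_least)
  then show ?thesis using T[of f] T[of g] by simp
qed

section \<open>Passage to several dimensions by integration over fibres\<close>

interpretation lborel_PiM: product_sigma_finite "\<lambda>_. lborel :: real measure"
  by standard

text \<open>Integrating out one coordinate preserves the hypothesis, by the one-dimensional case on
  the fibres, so induction on the coordinate set works. Extensional functions are exactly the points
  of the product space, where the fibre maps are measurable.\<close>

lemma prekopa_leindler_PiM:
  fixes f g h :: "('i \<Rightarrow> real) \<Rightarrow> ennreal"
  assumes "finite I"
    and "f \<in> borel_measurable (Pi\<^sub>M I (\<lambda>_. lborel))" "g \<in> borel_measurable (Pi\<^sub>M I (\<lambda>_. lborel))"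
      "h \<in> borel_measurable (Pi\<^sub>M I (\<lambda>_. lborel))"
    and "\<And>x y. x \<in> extensional I \<Longrightarrow> y \<in> extensional I \<Longrightarrow> f x * g y \<le> (h (\<lambda>j. (x j + y j) / 2))\<^sup>2"
  shows "integral\<^sup>N (Pi\<^sub>M I (\<lambda>_. lborel)) f * integral\<^sup>N (Pi\<^sub>M I (\<lambda>_. lborel)) g
    \<le> (integral\<^sup>N (Pi\<^sub>M I (\<lambda>_. lborel)) h)\<^sup>2"
  using assms
proof (induction I arbitrary: f g h)
  case empty
  \<comment> \<open>The empty product is a one-point space, its point being
    \<open>\<lambda>_. undefined\<close>.\<close>
  show ?case
    using empty(4)[of "\<lambda>_. undefined" "\<lambda>_. undefined"] by (simp add: PiM_empty nn_integral_count_space_finite)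
next
  case (insert i I)
  note [measurable] = insert.prems(1-3)
  define S where "S u x = (\<integral>\<^sup>+y. u (x(i := y)) \<partial>lborel)" for u :: "('i \<Rightarrow> real) \<Rightarrow> ennreal" and x
  have meas: "S u \<in> borel_measurable (Pi\<^sub>M I (\<lambda>_. lborel))"
    if [measurable]: "u \<in> borel_measurable (Pi\<^sub>M (insert i I) (\<lambda>_. lborel))" for u
    unfolding S_def by measurable
  have int: "integral\<^sup>N (Pi\<^sub>M (insert i I) (\<lambda>_. lborel)) u = integral\<^sup>N (Pi\<^sub>M I (\<lambda>_. lborel)) (S u)"
    if "u \<in> borel_measurable (Pi\<^sub>M (insert i I) (\<lambda>_. lborel))" for u
    unfolding S_def by (rule lborel_PiM.product_nn_integral_insert[OF insert.hyps that])
  have fib: "(\<lambda>y. u (x(i := y))) \<in> borel_measurable borel"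
    if u: "u \<in> borel_measurable (Pi\<^sub>M (insert i I) (\<lambda>_. lborel))" and x: "x \<in> extensional I" for u x
  proof -
    have "x \<in> space (Pi\<^sub>M I (\<lambda>_. lborel))" using x by (simp add: space_PiM PiE_def)
    from measurable_comp[OF measurable_component_update[OF this insert.hyps(2)] u]
    show ?thesis by (simp add: comp_def)
  qed
  have "integral\<^sup>N (Pi\<^sub>M I (\<lambda>_. lborel)) (S f) * integral\<^sup>N (Pi\<^sub>M I (\<lambda>_. lborel)) (S g)
      \<le> (integral\<^sup>N (Pi\<^sub>M I (\<lambda>_. lborel)) (S h))\<^sup>2"
  proof (rule insert.IH)
    fix x y :: "'i \<Rightarrow> real" assume xy: "x \<in> extensional I" "y \<in> extensional I"
    \<comment> \<open>Outside \<open>I\<close> both values are \<open>undefined\<close>, and so is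
      their average.\<close>
    have m: "(\<lambda>j. (x j + y j) / 2) \<in> extensional I" using xy by (auto simp: extensional_def)
    show "S f x * S g y \<le> (S h (\<lambda>j. (x j + y j) / 2))\<^sup>2"
      unfolding S_def
    proof (rule prekopa_leindler_real)
      fix p q
      have "(\<lambda>j. ((x(i := p)) j + (y(i := q)) j) / 2) = (\<lambda>j. (x j + y j) / 2)(i := (p + q) / 2)"
        by auto
      moreover have "x(i := p) \<in> extensional (insert i I)" "y(i := q) \<in> extensional (insert i I)"
        using xy by (auto simp: extensional_def)
      ultimately show "f (x(i := p)) * g (y(i := q)) \<le> (h ((\<lambda>j. (x j + y j) / 2)(i := (p + q) / 2)))\<^sup>2"
        using insert.prems(4) by metis
    next
      show "(\<lambda>p. f (x(i := p))) \<in> borel_measurable borel"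
        by (rule fib[OF insert.prems(1) xy(1)])
      show "(\<lambda>p. g (y(i := p))) \<in> borel_measurable borel"
        by (rule fib[OF insert.prems(2) xy(2)])
      show "(\<lambda>p. h ((\<lambda>j. (x j + y j) / 2)(i := p))) \<in> borel_measurable borel"
        by (rule fib[OF insert.prems(3) m])
    qed
  qed (use meas insert.prems(1-3) in auto)
  then show ?case using int insert.prems(1-3) by simp
qed

text \<open>Lebesgue measure is the image of the product measure under the coordinate map
  \<open>T\<close>, which is linear and hence respects midpoints.\<close>

theorem prekopa_leindler:
  fixes f g h :: "'a::euclidean_space \<Rightarrow> ennreal"
  assumes [measurable]: "f \<in> borel_measurable borel" "g \<in> borel_measurable borel" "h \<in> borel_measurable borel"
    and le: "\<And>x y. f x * g y \<le> (h ((1/2) *\<^sub>R (x + y)))\<^sup>2"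
  shows "(\<integral>\<^sup>+x. f x \<partial>lborel) * (\<integral>\<^sup>+x. g x \<partial>lborel) \<le> (\<integral>\<^sup>+x. h x \<partial>lborel)\<^sup>2"
proof -
  define T where "T v = (\<Sum>b\<in>Basis. v b *\<^sub>R b)" for v :: "'a \<Rightarrow> real"
  have [measurable]: "T \<in> borel_measurable (Pi\<^sub>M Basis (\<lambda>_. lborel))"
    unfolding T_def by measurable
  have int: "(\<integral>\<^sup>+x. u x \<partial>lborel) = (\<integral>\<^sup>+v. u (T v) \<partial>Pi\<^sub>M Basis (\<lambda>_. lborel))"
    if [measurable]: "u \<in> borel_measurable borel" for u :: "'a \<Rightarrow> ennreal"
    by (subst lborel_eq) (simp add: nn_integral_distr T_def[symmetric])
  have mid: "T (\<lambda>j. (x j + y j) / 2) = (1/2) *\<^sub>R (T x + T y)" for x y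
    by (simp add: T_def scaleR_sum_right sum.distrib[symmetric] scaleR_add_left[symmetric] add_divide_distrib)
  show ?thesis
    unfolding int[OF assms(1)] int[OF assms(2)] int[OF assms(3)]
    by (rule prekopa_leindler_PiM) (auto simp: mid intro: le)
qed

section \<open>Affine and linear changes of variables\<close>

lemma nn_integral_lborel_affine:
  fixes f :: "'a::euclidean_space \<Rightarrow> ennreal"
  assumes [measurable]: "f \<in> borel_measurable borel" and c: "c \<noteq> 0"
  shows "(\<integral>\<^sup>+x. f x \<partial>lborel) = ennreal (\<bar>c\<bar> ^ DIM('a)) * (\<integral>\<^sup>+x. f (t + c *\<^sub>R x) \<partial>lborel)"
  by (subst lborel_affine[OF c, of t])
     (simp add: nn_integral_density nn_integral_distr nn_integral_cmult)

text \<open>Two substitutions in one variable each, with the order of integration exchanged in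
  between, produce the factors \<open>k\<close> and \<open>\<alpha>\<close>, whose product is the
  determinant.\<close>

lemma nn_integral_lborel_linear_pair:
  fixes F :: "'a::euclidean_space \<Rightarrow> 'a \<Rightarrow> ennreal"
  assumes F: "(\<lambda>(x, y). F x y) \<in> borel_measurable (borel \<Otimes>\<^sub>M borel)"
    and nz: "\<alpha> \<noteq> 0" "\<alpha> * \<delta> - \<beta> * \<gamma> \<noteq> 0"
  shows "(\<integral>\<^sup>+x. \<integral>\<^sup>+y. F x y \<partial>lborel \<partial>lborel) =
    ennreal (\<bar>\<alpha> * \<delta> - \<beta> * \<gamma>\<bar> ^ DIM('a)) *
      (\<integral>\<^sup>+u. \<integral>\<^sup>+w. F (\<alpha> *\<^sub>R u + \<beta> *\<^sub>R w) (\<gamma> *\<^sub>R u + \<delta> *\<^sub>R w) \<partial>lborel \<partial>lborel)"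
proof -
  \<comment> \<open>The Schur complement: for \<open>x = \<alpha> u + \<beta> w\<close> one has
    \<open>\<gamma> u + \<delta> w = (\<gamma> / \<alpha>) x + k w\<close>.\<close>
  define k where "k = \<delta> - \<beta> * \<gamma> / \<alpha>"
  have k: "k \<noteq> 0" "\<alpha> * k = \<alpha> * \<delta> - \<beta> * \<gamma>" using nz by (auto simp: k_def field_simps)
  have Fm: "(\<lambda>p. F (a p) (b p)) \<in> borel_measurable M"
    if "a \<in> M \<rightarrow>\<^sub>M borel" "b \<in> M \<rightarrow>\<^sub>M borel" for a b and M :: "'c measure"
    using measurable_compose[OF measurable_Pair[OF that] F] by simp
  have Fm2: "(\<lambda>p. F (a p) (b p)) \<in> borel_measurable M"
    if "a \<in> M \<rightarrow>\<^sub>M borel" "b \<in> M \<rightarrow>\<^sub>M borel" for a b and M :: "('c \<times> 'd) measure"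
    using measurable_compose[OF measurable_Pair[OF that] F] by simp
  have "(\<integral>\<^sup>+x. \<integral>\<^sup>+y. F x y \<partial>lborel \<partial>lborel)
      = (\<integral>\<^sup>+x. ennreal (\<bar>k\<bar> ^ DIM('a)) * (\<integral>\<^sup>+w. F x ((\<gamma> / \<alpha>) *\<^sub>R x + k *\<^sub>R w) \<partial>lborel) \<partial>lborel)"
    by (intro nn_integral_cong nn_integral_lborel_affine Fm k) auto
  also have "\<dots> = ennreal (\<bar>k\<bar> ^ DIM('a)) * (\<integral>\<^sup>+x. \<integral>\<^sup>+w. F x ((\<gamma> / \<alpha>) *\<^sub>R x + k *\<^sub>R w) \<partial>lborel \<partial>lborel)"
    by (rule nn_integral_cmult) (measurable, rule Fm2, measurable)
  also have "(\<integral>\<^sup>+x. \<integral>\<^sup>+w. F x ((\<gamma> / \<alpha>) *\<^sub>R x + k *\<^sub>R w) \<partial>lborel \<partial>lborel)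
      = (\<integral>\<^sup>+w. \<integral>\<^sup>+x. F x ((\<gamma> / \<alpha>) *\<^sub>R x + k *\<^sub>R w) \<partial>lborel \<partial>lborel)"
    by (rule lborel_pair.Fubini') (unfold split_beta', rule Fm2; measurable)
  also have "\<dots> = (\<integral>\<^sup>+w. ennreal (\<bar>\<alpha>\<bar> ^ DIM('a)) *
      (\<integral>\<^sup>+u. F (\<beta> *\<^sub>R w + \<alpha> *\<^sub>R u) ((\<gamma> / \<alpha>) *\<^sub>R (\<beta> *\<^sub>R w + \<alpha> *\<^sub>R u) + k *\<^sub>R w) \<partial>lborel) \<partial>lborel)"
    by (intro nn_integral_cong nn_integral_lborel_affine Fm nz) auto
  also have "\<dots> = (\<integral>\<^sup>+w. ennreal (\<bar>\<alpha>\<bar> ^ DIM('a)) *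
      (\<integral>\<^sup>+u. F (\<alpha> *\<^sub>R u + \<beta> *\<^sub>R w) (\<gamma> *\<^sub>R u + \<delta> *\<^sub>R w) \<partial>lborel) \<partial>lborel)"
  proof -
    have "(\<gamma> / \<alpha>) *\<^sub>R (\<beta> *\<^sub>R w + \<alpha> *\<^sub>R u) + k *\<^sub>R w = \<gamma> *\<^sub>R u + \<delta> *\<^sub>R w" for u w :: 'a
    proof -
      have "(\<gamma> / \<alpha>) *\<^sub>R (\<beta> *\<^sub>R w + \<alpha> *\<^sub>R u) + k *\<^sub>R w = (\<gamma> / \<alpha> * \<alpha>) *\<^sub>R u + (\<gamma> / \<alpha> * \<beta> + k) *\<^sub>R w"
        by (simp add: algebra_simps)
      moreover have "\<gamma> / \<alpha> * \<alpha> = \<gamma>" "\<gamma> / \<alpha> * \<beta> + k = \<delta>" using nz by (auto simp: k_def)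
      ultimately show ?thesis by simp
    qed
    then show ?thesis by (simp add: add.commute)
  qed
  also have "\<dots> = ennreal (\<bar>\<alpha>\<bar> ^ DIM('a)) *
      (\<integral>\<^sup>+w. \<integral>\<^sup>+u. F (\<alpha> *\<^sub>R u + \<beta> *\<^sub>R w) (\<gamma> *\<^sub>R u + \<delta> *\<^sub>R w) \<partial>lborel \<partial>lborel)"
    by (rule nn_integral_cmult) (measurable, rule Fm2, measurable)
  also have "(\<integral>\<^sup>+w. \<integral>\<^sup>+u. F (\<alpha> *\<^sub>R u + \<beta> *\<^sub>R w) (\<gamma> *\<^sub>R u + \<delta> *\<^sub>R w) \<partial>lborel \<partial>lborel)
     = (\<integral>\<^sup>+u. \<integral>\<^sup>+w. F (\<alpha> *\<^sub>R u + \<beta> *\<^sub>R w) (\<gamma> *\<^sub>R u + \<delta> *\<^sub>R w) \<partial>lborel \<partial>lborel)"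
    by (rule lborel_pair.Fubini') (unfold split_beta', rule Fm2; measurable)
  finally show ?thesis
    by (simp add: mult.assoc[symmetric] ennreal_mult[symmetric] power_mult_distrib[symmetric]
        abs_mult[symmetric] mult.commute[of k] k)
qed

section \<open>A midpoint inequality for symmetric sets\<close>

text \<open>On the nonnegative half-line \<open>x - tanh x\<close> has derivative
  \<open>(tanh x)^2\<close> and \<open>x^2 / 2 - ln (cosh x)\<close> has derivative
  \<open>x - tanh x\<close>; both vanish at 0, so both are nonnegative. Evenness covers negative
  arguments.\<close>

lemma cosh_le_exp_half_square: "cosh x \<le> exp (x\<^sup>2 / 2)" for x :: real
proof -
  have tanh: "tanh y \<le> y" if "0 \<le> y" for y :: real
  proof -
    have "(\<lambda>x. x - tanh x) 0 \<le> (\<lambda>x. x - tanh x) y"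
    proof (rule DERIV_nonneg_imp_nondecreasing[OF that])
      fix x :: real
      show "\<exists>d. ((\<lambda>x. x - tanh x) has_real_derivative d) (at x) \<and> 0 \<le> d"
        by (intro exI[of _ "(tanh x)\<^sup>2"] conjI) (auto intro!: derivative_eq_intros)
    qed
    then show ?thesis by simp
  qed
  have *: "cosh y \<le> exp (y\<^sup>2 / 2)" if "0 \<le> y" for y :: real
  proof -
    have "(\<lambda>x. x\<^sup>2 / 2 - ln (cosh x)) 0 \<le> (\<lambda>x. x\<^sup>2 / 2 - ln (cosh x)) y"
    proof (rule DERIV_nonneg_imp_nondecreasing[OF that])
      fix x :: real assume "0 \<le> x"
      then show "\<exists>d. ((\<lambda>x. x\<^sup>2 / 2 - ln (cosh x)) has_real_derivative d) (at x) \<and> 0 \<le> d"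
        using tanh[of x]
        by (intro exI[of _ "x - tanh x"] conjI) (auto intro!: derivative_eq_intros simp: tanh_def)
    qed
    then have "ln (cosh y) \<le> y\<^sup>2 / 2" by simp
    then show ?thesis by (metis cosh_real_pos exp_le_cancel_iff exp_ln)
  qed
  show ?thesis using *[of x] *[of "- x"] by (cases "0 \<le> x") auto
qed

text \<open>Unnormalized, since the inequalities are homogeneous in the measure and the constant can
  be restored at the end. The integral is over \<open>lborel\<close>, where the product and
  substitution rules apply.\<close>

definition gauss_mass :: "'a::euclidean_space set \<Rightarrow> ennreal" where
  "gauss_mass A = (\<integral>\<^sup>+x. ennreal (exp (- (norm x)\<^sup>2 / 2)) * indicator A x \<partial>lborel)"

lemma ennreal_power2_le_imp_le: "x\<^sup>2 \<le> y\<^sup>2 \<Longrightarrow> x \<le> y" for x y :: ennreal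
proof (cases "y = top")
  case False
  assume le: "x\<^sup>2 \<le> y\<^sup>2"
  then have "x \<noteq> top" using False by (auto simp: power2_eq_square ennreal_top_mult top_unique ennreal_mult_eq_top_iff)
  with False obtain p q where "x = ennreal p" "0 \<le> p" "y = ennreal q" "0 \<le> q" by (metis ennreal_cases)
  with le show ?thesis by (auto simp: ennreal_power intro!: ennreal_leI power2_le_imp_le)
qed simp

text \<open>Apply Prekopa-Leindler to \<open>f\<close> and its reflection, which have the same
  integral, and take square roots. On a fibre this is the passage to half the difference
  set.\<close>

lemma nn_integral_le_of_reflection:
  fixes f h :: "'a::euclidean_space \<Rightarrow> ennreal"
  assumes [measurable]: "f \<in> borel_measurable borel" "h \<in> borel_measurable borel"
    and le: "\<And>x y. f x * f y \<le> (h ((1/2) *\<^sub>R (x - y)))\<^sup>2"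
  shows "(\<integral>\<^sup>+x. f x \<partial>lborel) \<le> (\<integral>\<^sup>+x. h x \<partial>lborel)"
proof -
  have "(\<integral>\<^sup>+x. f x \<partial>lborel) = (\<integral>\<^sup>+x. f (- x) \<partial>lborel)"
    by (subst nn_integral_lborel_affine[where c = "-1" and t = 0]) auto
  moreover have "(\<integral>\<^sup>+x. f x \<partial>lborel) * (\<integral>\<^sup>+x. f (- x) \<partial>lborel) \<le> (\<integral>\<^sup>+x. h x \<partial>lborel)\<^sup>2"
  proof (rule prekopa_leindler)
    show "f x * f (- y) \<le> (h ((1/2) *\<^sub>R (x + y)))\<^sup>2" for x y
      using le[of x "- y"] by simp
  qed measurable
  ultimately have "(\<integral>\<^sup>+x. f x \<partial>lborel)\<^sup>2 \<le> (\<integral>\<^sup>+x. h x \<partial>lborel)\<^sup>2"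
    unfolding power2_eq_square by metis
  then show ?thesis by (rule ennreal_power2_le_imp_le)
qed

lemma gauss_mass_prod_integral:
  fixes A B :: "'a::euclidean_space set"
  assumes [measurable]: "A \<in> sets borel" "B \<in> sets borel"
  shows "gauss_mass A * gauss_mass B =
    (\<integral>\<^sup>+x. \<integral>\<^sup>+y. ennreal (exp (- ((norm x)\<^sup>2 + (norm y)\<^sup>2) / 2)) * (indicator A x * indicator B y) \<partial>lborel \<partial>lborel)"
proof -
  have "gauss_mass A * gauss_mass B =
    (\<integral>\<^sup>+x. ennreal (exp (- (norm x)\<^sup>2 / 2)) * indicator A x * gauss_mass B \<partial>lborel)"
    unfolding gauss_mass_def[of A] by (rule nn_integral_multc[symmetric]) measurable
  also have "\<dots> = (\<integral>\<^sup>+x. \<integral>\<^sup>+y. ennreal (exp (- (norm x)\<^sup>2 / 2)) * indicator A x *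
      (ennreal (exp (- (norm y)\<^sup>2 / 2)) * indicator B y) \<partial>lborel \<partial>lborel)"
    unfolding gauss_mass_def by (intro nn_integral_cong nn_integral_cmult[symmetric]) measurable
  also have "\<dots> = (\<integral>\<^sup>+x. \<integral>\<^sup>+y. ennreal (exp (- ((norm x)\<^sup>2 + (norm y)\<^sup>2) / 2)) * (indicator A x * indicator B y) \<partial>lborel \<partial>lborel)"
  proof -
    have "ennreal (exp (- (norm x)\<^sup>2 / 2)) * indicator A x * (ennreal (exp (- (norm y)\<^sup>2 / 2)) * indicator B y)
      = ennreal (exp (- ((norm x)\<^sup>2 + (norm y)\<^sup>2) / 2)) * (indicator A x * indicator B y)" for x y
    proof -
      have "ennreal (exp (- ((norm x)\<^sup>2 + (norm y)\<^sup>2) / 2)) = ennreal (exp (- (norm x)\<^sup>2 / 2)) * ennreal (exp (- (norm y)\<^sup>2 / 2))"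
        by (simp add: ennreal_mult[symmetric] exp_add[symmetric] field_simps)
      then show ?thesis by (simp add: ac_simps)
    qed
    then show ?thesis by simp
  qed
  finally show ?thesis .
qed

lemma exp_add_plus_exp_diff: "exp (x + y) + exp (x - y) = 2 * (exp x * cosh y)" for x y :: real
proof -
  have "exp (x - y) = exp x * exp (- y)" unfolding exp_add[symmetric] by simp
  then show ?thesis by (simp add: exp_add cosh_def distrib_left)
qed

text \<open>The exponents are \<open>- (A1 + A2) S\<close> plus or minus
  \<open>2 (A2 - A1) z\<close>, so the sum is a \<open>cosh\<close>. Its Gaussian bound, quadratic
  in the inner product \<open>z\<close>, is absorbed by the excess of \<open>A1 + A2\<close> over
  \<open>1/2\<close>.\<close>

lemma symmetrized_weight_le:
  fixes p q :: "'a::euclidean_space" and A1 A2 R :: real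
  assumes R: "norm p \<le> R" "norm q \<le> R" and small: "(A2 - A1)\<^sup>2 * R\<^sup>2 \<le> A1 + A2 - 1/2"
  shows "exp (- (A1 * (norm (p + q))\<^sup>2 + A2 * (norm (p - q))\<^sup>2)) + exp (- (A1 * (norm (- p + q))\<^sup>2 + A2 * (norm (- p - q))\<^sup>2))
    \<le> 2 * exp (- ((norm p)\<^sup>2 + (norm q)\<^sup>2) / 2)"
proof -
  define S z where "S = (norm p)\<^sup>2 + (norm q)\<^sup>2" and "z = p \<bullet> q"
  have R0: "0 \<le> R" using R(1) norm_ge_zero[of p] by linarith
  have S0: "0 \<le> S" by (simp add: S_def)
  have 1: "- (A1 * (norm (p + q))\<^sup>2 + A2 * (norm (p - q))\<^sup>2) = - (A1 + A2) * S + 2 * (A2 - A1) * z"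
    unfolding S_def z_def power2_norm_eq_inner by (simp add: algebra_simps inner_commute)
  have 2: "- (A1 * (norm (- p + q))\<^sup>2 + A2 * (norm (- p - q))\<^sup>2) = - (A1 + A2) * S - 2 * (A2 - A1) * z"
    unfolding S_def z_def power2_norm_eq_inner by (simp add: algebra_simps inner_commute)
  have "z\<^sup>2 \<le> (norm p * norm q)\<^sup>2"
    unfolding z_def by (metis Cauchy_Schwarz_ineq2 abs_ge_zero power2_abs power_mono)
  also have "\<dots> = (norm p * norm q) * (norm p * norm q)" by (simp add: power2_eq_square)
  \<comment> \<open>One factor is bounded by the radius, the other by AM-GM, which keeps the bound
    linear in \<open>S\<close>.\<close>
  also have "\<dots> \<le> (R * R) * (S / 2)"
  proof (rule mult_mono)
    show "norm p * norm q \<le> R * R" using R R0 by (intro mult_mono) auto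
    show "norm p * norm q \<le> S / 2" using sum_squares_bound[of "norm p" "norm q"] by (simp add: S_def)
  qed (auto simp: zero_le_mult_iff)
  finally have z: "2 * z\<^sup>2 \<le> R\<^sup>2 * S" by (simp add: power2_eq_square)
  have "(2 * c * z)\<^sup>2 / 2 = c\<^sup>2 * (2 * z\<^sup>2)" for c :: real
    by (simp add: power_mult_distrib)
  then have "(2 * (A2 - A1) * z)\<^sup>2 / 2 = (A2 - A1)\<^sup>2 * (2 * z\<^sup>2)" by blast
  also have "\<dots> \<le> (A2 - A1)\<^sup>2 * (R\<^sup>2 * S)" using z by (rule mult_left_mono) simp
  also have "\<dots> = ((A2 - A1)\<^sup>2 * R\<^sup>2) * S" by simp
  also have "\<dots> \<le> (A1 + A2 - 1/2) * S" using small S0 by (rule mult_right_mono)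
  finally have *: "(2 * (A2 - A1) * z)\<^sup>2 / 2 \<le> (A1 + A2 - 1/2) * S" .
  have "exp (- (A1 + A2) * S + 2 * (A2 - A1) * z) + exp (- (A1 + A2) * S - 2 * (A2 - A1) * z)
     = 2 * (exp (- (A1 + A2) * S) * cosh (2 * (A2 - A1) * z))"
    by (rule exp_add_plus_exp_diff)
  also have "\<dots> \<le> 2 * (exp (- (A1 + A2) * S) * exp ((2 * (A2 - A1) * z)\<^sup>2 / 2))"
    by (intro mult_left_mono cosh_le_exp_half_square) auto
  also have "\<dots> = 2 * exp (- (A1 + A2) * S + (2 * (A2 - A1) * z)\<^sup>2 / 2)"
    by (simp add: exp_add)
  also have "\<dots> \<le> 2 * exp (- S / 2)"
    using * by (simp add: algebra_simps)
  finally show ?thesis unfolding 1 2 by (simp add: S_def)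
qed

text \<open>This is the smallness condition of \<open>symmetrized_weight_le\<close> for the weights
  that occur below. With \<open>b = a^2\<close> the weights differ by \<open>b / d\<close> and add
  up to \<open>(1 + b^2) / (2 d)\<close>: the left side is of order \<open>b^2 R^2\<close>, while
  the right side is at least \<open>b / 2\<close>.\<close>

lemma small_parameter:
  fixes a R :: real
  assumes a: "a\<^sup>2 \<le> 1 / 4" "a\<^sup>2 * (8 * R\<^sup>2) \<le> 1"
  shows "((1 + a\<^sup>2) / (4 * (1 - a\<^sup>2)\<^sup>2) - 1 / (4 * (1 + a\<^sup>2)))\<^sup>2 * R\<^sup>2
    \<le> 1 / (4 * (1 + a\<^sup>2)) + (1 + a\<^sup>2) / (4 * (1 - a\<^sup>2)\<^sup>2) - 1 / 2"
proof -
  define b where "b = a\<^sup>2"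
  have b: "0 \<le> b" "b \<le> 1/4" "b * (8 * R\<^sup>2) \<le> 1" using a by (auto simp: b_def)
  define d where "d = (1 + b) * (1 - b)\<^sup>2"
  have d: "d = (1 - b\<^sup>2) * (1 - b)" by (simp add: d_def power2_eq_square algebra_simps)
  have b2: "b\<^sup>2 \<le> b / 4"
    using mult_right_mono[of b "1/4" b] b by (simp add: power2_eq_square)
  have "d \<ge> (15/16) * (3/4)" unfolding d using b b2 by (intro mult_mono) auto
  then have d0: "1/2 \<le> d" by simp
  have dif: "(1 + b) / (4 * (1 - b)\<^sup>2) - 1 / (4 * (1 + b)) = b / d"
    using b by (simp add: d_def divide_simps power2_eq_square) (simp add: algebra_simps)
  have sm: "1 / (4 * (1 + b)) + (1 + b) / (4 * (1 - b)\<^sup>2) = (1 + b\<^sup>2) / (2 * d)"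
    using b by (simp add: d_def divide_simps power2_eq_square) (simp add: algebra_simps)
  have bd: "b / d \<le> 2 * b" "0 \<le> b / d"
    using b d0 mult_left_mono[of "1/2" d "2*b"] by (auto simp: divide_le_eq)
  have "(b / d)\<^sup>2 * R\<^sup>2 \<le> (2 * b)\<^sup>2 * R\<^sup>2" using bd by (intro mult_right_mono power_mono) auto
  also have "\<dots> = (b * (8 * R\<^sup>2)) * (b / 2)" by (simp add: power2_eq_square)
  also have "\<dots> \<le> 1 * (b / 2)" using b by (intro mult_right_mono) auto
  finally have L: "(b / d)\<^sup>2 * R\<^sup>2 \<le> b / 2" by simp
  \<comment> \<open>This product being at most 1 yields the lower bound \<open>(1 + b) / 2\<close>
    for the sum of the weights.\<close>
  have "(1 + b) * d = (1 - b\<^sup>2)\<^sup>2" by (simp add: d power2_eq_square algebra_simps)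
  also have "\<dots> \<le> 1 ^ 2" using b b2 by (intro power_mono) auto
  finally have "(1 + b) * d \<le> 1 + b\<^sup>2" by (smt (verit) one_power2 zero_le_power2)
  then have "(1 + b) / 2 \<le> (1 + b\<^sup>2) / (2 * d)" using d0 by (simp add: field_simps)
  then have "b / 2 \<le> (1 + b\<^sup>2) / (2 * d) - 1 / 2" by (simp add: add_divide_distrib)
  with L show ?thesis unfolding b_def[symmetric] dif sm by linarith
qed

text \<open>The factor \<open>(1 - a^2)^n\<close>, \<open>n\<close> the dimension, is a quotient of
  Jacobians: the substitution for \<open>A\<close> and \<open>B\<close> has determinant of size
  \<open>2 s\<close>, the one for the two points of \<open>C\<close> has \<open>2 s d\<close>.
  Between them stands the reflection inequality on the fibres over \<open>u\<close>.\<close>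

lemma gauss_mass_midpoint:
  fixes A B C :: "'a::euclidean_space set" and a :: real
  assumes [measurable]: "A \<in> sets borel" "B \<in> sets borel" "C \<in> sets borel"
    and mid: "\<And>x y. x \<in> A \<Longrightarrow> y \<in> B \<Longrightarrow> (1/2) *\<^sub>R ((1 + a) *\<^sub>R x + (1 - a) *\<^sub>R y) \<in> C"
    and sym: "\<And>x. x \<in> C \<Longrightarrow> - x \<in> C"
    and R: "\<And>x. x \<in> C \<Longrightarrow> norm x \<le> R"
    and a: "a\<^sup>2 \<le> 1 / 4" "a\<^sup>2 * (8 * R\<^sup>2) \<le> 1"
  shows "ennreal ((1 - a\<^sup>2) ^ DIM('a)) * (gauss_mass A * gauss_mass B) \<le> (gauss_mass C)\<^sup>2"
proof -
  let ?n = "DIM('a)"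
  define s d where "s = 1 + a\<^sup>2" and "d = 1 - a\<^sup>2"
  have sd: "0 < s" "0 < d" using a(1) by (auto simp: s_def d_def add_pos_nonneg)
  have "\<bar>a\<bar> \<le> 1/2" using a(1) abs_le_square_iff[of a "1/2"] by (simp add: power2_eq_square)
  then have a1: "1 + a \<noteq> 0" by auto
  \<comment> \<open>Chosen so that for \<open>p + q = 2 s u\<close> and \<open>p - q = 2 d w\<close>
    the exponent of \<open>P\<close> becomes that of \<open>H\<close>.\<close>
  define A1 A2 where "A1 = 1 / (4 * s)" and "A2 = s / (4 * d\<^sup>2)"
  define F where "F x y = ennreal (exp (- ((norm x)\<^sup>2 + (norm y)\<^sup>2) / 2)) * (indicator A x * indicator B y)" for x y
  define H where "H u w = ennreal (exp (- s * ((norm u)\<^sup>2 + (norm w)\<^sup>2))) *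
      (indicator C (s *\<^sub>R u + d *\<^sub>R w) * indicator C (s *\<^sub>R u + (- d) *\<^sub>R w))" for u w
  define P where "P p q = ennreal (exp (- (A1 * (norm (p + q))\<^sup>2 + A2 * (norm (p - q))\<^sup>2))) *
      (indicator C p * indicator C q)" for p q
  have Fm [measurable]: "(\<lambda>(x, y). F x y) \<in> borel_measurable (borel \<Otimes>\<^sub>M borel)"
    unfolding F_def by measurable
  have Pm [measurable]: "(\<lambda>(x, y). P x y) \<in> borel_measurable (borel \<Otimes>\<^sub>M borel)"
    unfolding P_def by measurable
  have PH: "P (s *\<^sub>R u + d *\<^sub>R w) (s *\<^sub>R u + (- d) *\<^sub>R w) = H u w" for u w
  proof -
    have 1: "(s *\<^sub>R u + d *\<^sub>R w) + (s *\<^sub>R u + (- d) *\<^sub>R w) = (2 * s) *\<^sub>R u"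
      by (simp flip: scaleR_add_left)
    have 2: "(s *\<^sub>R u + d *\<^sub>R w) - (s *\<^sub>R u + (- d) *\<^sub>R w) = (2 * d) *\<^sub>R w"
      by (simp flip: scaleR_add_left)
    have "A1 * (norm ((2 * s) *\<^sub>R u))\<^sup>2 = s * (norm u)\<^sup>2" "A2 * (norm ((2 * d) *\<^sub>R w))\<^sup>2 = s * (norm w)\<^sup>2"
      using sd by (auto simp: A1_def A2_def power_mult_distrib power2_eq_square)
    then have 3: "A1 * (norm ((2 * s) *\<^sub>R u))\<^sup>2 + A2 * (norm ((2 * d) *\<^sub>R w))\<^sup>2 = s * ((norm u)\<^sup>2 + (norm w)\<^sup>2)"
      by (simp only: distrib_left)
    show ?thesis unfolding P_def H_def 1 2 3 by simp
  qed
  have FH: "(\<integral>\<^sup>+w. F ((1 + a) *\<^sub>R u + (1 - a) *\<^sub>R w) ((1 - a) *\<^sub>R u + (- (1 + a)) *\<^sub>R w) \<partial>lborel)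
      \<le> (\<integral>\<^sup>+w. H u w \<partial>lborel)" for u
  proof (rule nn_integral_le_of_reflection)
    show "(\<lambda>w. F ((1 + a) *\<^sub>R u + (1 - a) *\<^sub>R w) ((1 - a) *\<^sub>R u + (- (1 + a)) *\<^sub>R w)) \<in> borel_measurable borel"
      unfolding F_def by measurable
    show "H u \<in> borel_measurable borel" unfolding H_def by measurable
    fix w v :: 'a
    let ?x = "\<lambda>w. (1 + a) *\<^sub>R u + (1 - a) *\<^sub>R w" and ?y = "\<lambda>w. (1 - a) *\<^sub>R u + (- (1 + a)) *\<^sub>R w"
    define m where "m = (1/2) *\<^sub>R (w - v)"
    show "F (?x w) (?y w) * F (?x v) (?y v) \<le> (H u ((1/2) *\<^sub>R (w - v)))\<^sup>2"
    proof (cases "?x w \<in> A \<and> ?y w \<in> B \<and> ?x v \<in> A \<and> ?y v \<in> B")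
      case False
      then show ?thesis by (auto simp: F_def indicator_def)
    next
      case True
      \<comment> \<open>The substitution is orthogonal up to the factor \<open>2 s\<close>: the
        cross terms cancel.\<close>
      have e: "(norm (?x z))\<^sup>2 + (norm (?y z))\<^sup>2 = 2 * (s * ((norm u)\<^sup>2 + (norm z)\<^sup>2))" for z
        unfolding power2_norm_eq_inner s_def
        by (simp add: algebra_simps inner_commute power2_eq_square)
      \<comment> \<open>Pairing the first point of one fibre element with the second point of the
        other keeps \<open>u\<close> and leaves only the half difference \<open>m\<close>.\<close>
      have c1: "(1/2) *\<^sub>R ((1 + a) *\<^sub>R ?x w + (1 - a) *\<^sub>R ?y v) = s *\<^sub>R u + d *\<^sub>R m"
        unfolding s_def d_def m_def
        by (rule euclidean_eqI) (simp add: inner_simps power2_eq_square field_simps)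
      have c2: "(1/2) *\<^sub>R ((1 + a) *\<^sub>R ?x v + (1 - a) *\<^sub>R ?y w) = s *\<^sub>R u + (- d) *\<^sub>R m"
        unfolding s_def d_def m_def
        by (rule euclidean_eqI) (simp add: inner_simps power2_eq_square field_simps)
      have "s *\<^sub>R u + d *\<^sub>R m \<in> C" "s *\<^sub>R u + (- d) *\<^sub>R m \<in> C"
        using mid[of "?x w" "?y v"] mid[of "?x v" "?y w"] True unfolding c1 c2 by auto
      then have H: "H u m = ennreal (exp (- s * ((norm u)\<^sup>2 + (norm m)\<^sup>2)))" by (simp add: H_def)
      have F: "F (?x z) (?y z) = ennreal (exp (- s * ((norm u)\<^sup>2 + (norm z)\<^sup>2)))" if "?x z \<in> A" "?y z \<in> B" for z
        using that unfolding F_def e by simp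
      \<comment> \<open>Parallelogram law: replacing \<open>w\<close> and \<open>v\<close> by
        \<open>m\<close> does not decrease the Gaussian weight.\<close>
      have "(norm w)\<^sup>2 + (norm v)\<^sup>2 - 2 * (norm m)\<^sup>2 = (norm (w + v))\<^sup>2 / 2"
        unfolding m_def power2_norm_eq_inner by (simp add: algebra_simps inner_commute)
      then have "2 * (norm m)\<^sup>2 \<le> (norm w)\<^sup>2 + (norm v)\<^sup>2" by (smt (verit) zero_le_power2 divide_nonneg_pos)
      then have "s * (2 * (norm m)\<^sup>2) \<le> s * ((norm w)\<^sup>2 + (norm v)\<^sup>2)" using sd by (intro mult_left_mono) auto
      then have "exp (- s * ((norm u)\<^sup>2 + (norm w)\<^sup>2)) * exp (- s * ((norm u)\<^sup>2 + (norm v)\<^sup>2))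
        \<le> exp (- s * ((norm u)\<^sup>2 + (norm m)\<^sup>2)) * exp (- s * ((norm u)\<^sup>2 + (norm m)\<^sup>2))"
        unfolding exp_add[symmetric] by (simp add: algebra_simps)
      then have "ennreal (exp (- s * ((norm u)\<^sup>2 + (norm w)\<^sup>2)) * exp (- s * ((norm u)\<^sup>2 + (norm v)\<^sup>2)))
        \<le> ennreal (exp (- s * ((norm u)\<^sup>2 + (norm m)\<^sup>2)) * exp (- s * ((norm u)\<^sup>2 + (norm m)\<^sup>2)))"
        by (rule ennreal_leI)
      moreover have "F (?x w) (?y w) = ennreal (exp (- s * ((norm u)\<^sup>2 + (norm w)\<^sup>2)))"
        "F (?x v) (?y v) = ennreal (exp (- s * ((norm u)\<^sup>2 + (norm v)\<^sup>2)))"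
        using F True by blast+
      ultimately show ?thesis
        unfolding m_def[symmetric] H power2_eq_square[of "ennreal _"]
        by (simp only: ennreal_mult exp_ge_zero)
    qed
  qed
  have det1: "(1 + a) * (- (1 + a)) - (1 - a) * (1 - a) = - (2 * s)"
    by (simp add: s_def power2_eq_square algebra_simps)
  have "gauss_mass A * gauss_mass B = (\<integral>\<^sup>+x. \<integral>\<^sup>+y. F x y \<partial>lborel \<partial>lborel)"
    unfolding F_def by (rule gauss_mass_prod_integral) auto
  also have "\<dots> = ennreal ((2 * s) ^ ?n) * (\<integral>\<^sup>+u. \<integral>\<^sup>+w. F ((1 + a) *\<^sub>R u + (1 - a) *\<^sub>R w) ((1 - a) *\<^sub>R u + (- (1 + a)) *\<^sub>R w) \<partial>lborel \<partial>lborel)"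
  proof -
    have "(1 + a) * (- (1 + a)) - (1 - a) * (1 - a) \<noteq> 0" "\<bar>- (2 * s)\<bar> = 2 * s"
      unfolding det1 using sd by auto
    then show ?thesis
      using nn_integral_lborel_linear_pair[of F "1 + a" "- (1 + a)" "1 - a" "1 - a"] a1 Fm
      by (simp only: det1 simp_thms)
  qed
  also have "\<dots> \<le> ennreal ((2 * s) ^ ?n) * (\<integral>\<^sup>+u. \<integral>\<^sup>+w. H u w \<partial>lborel \<partial>lborel)"
    by (intro mult_left_mono nn_integral_mono FH) simp
  finally have "ennreal (d ^ ?n) * (gauss_mass A * gauss_mass B)
      \<le> ennreal (d ^ ?n) * (ennreal ((2 * s) ^ ?n) * (\<integral>\<^sup>+u. \<integral>\<^sup>+w. H u w \<partial>lborel \<partial>lborel))"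
    by (rule mult_left_mono) simp
  also have "\<dots> = ennreal ((2 * s * d) ^ ?n) * (\<integral>\<^sup>+u. \<integral>\<^sup>+w. H u w \<partial>lborel \<partial>lborel)"
  proof -
    have "ennreal (d ^ ?n) * ennreal ((2 * s) ^ ?n) = ennreal (d ^ ?n * (2 * s) ^ ?n)"
      using sd by (intro ennreal_mult[symmetric]) auto
    also have "d ^ ?n * (2 * s) ^ ?n = (2 * s * d) ^ ?n"
      by (simp only: power_mult_distrib mult_ac)
    finally show ?thesis by (simp only: mult.assoc[symmetric])
  qed
  also have "\<dots> = (\<integral>\<^sup>+p. \<integral>\<^sup>+q. P p q \<partial>lborel \<partial>lborel)"
  proof -
    have "s * - d - d * s = - (2 * s * d)" by simp
    moreover have "s * - d - d * s \<noteq> 0" "\<bar>- (2 * s * d)\<bar> = 2 * s * d" using sd by auto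
    ultimately show ?thesis
      using nn_integral_lborel_linear_pair[of P s "- d" d s] sd(1) Pm by (simp only: PH) simp
  qed
  finally have main: "ennreal (d ^ ?n) * (gauss_mass A * gauss_mass B) \<le> (\<integral>\<^sup>+p. \<integral>\<^sup>+q. P p q \<partial>lborel \<partial>lborel)" .
  \<comment> \<open>Averaging over the sign of \<open>p\<close> is where the symmetry of
    \<open>C\<close> enters: \<open>p\<close> and \<open>- p\<close> lie in \<open>C\<close>
    together.\<close>
  have refl: "(\<integral>\<^sup>+p. \<integral>\<^sup>+q. P p q \<partial>lborel \<partial>lborel) = (\<integral>\<^sup>+p. \<integral>\<^sup>+q. P (- p) q \<partial>lborel \<partial>lborel)"
    by (subst nn_integral_lborel_affine[where c = "-1" and t = 0]) auto
  have sum: "P p q + P (- p) q \<le> 2 * (ennreal (exp (- ((norm p)\<^sup>2 + (norm q)\<^sup>2) / 2)) * (indicator C p * indicator C q))" for p q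
  proof (cases "p \<in> C \<and> q \<in> C")
    case True
    then have "- p \<in> C" using sym by auto
    then have "P p q + P (- p) q = ennreal (exp (- (A1 * (norm (p + q))\<^sup>2 + A2 * (norm (p - q))\<^sup>2)) + exp (- (A1 * (norm (- p + q))\<^sup>2 + A2 * (norm (- p - q))\<^sup>2)))"
      using True by (simp add: P_def)
    also have "\<dots> \<le> ennreal (2 * exp (- ((norm p)\<^sup>2 + (norm q)\<^sup>2) / 2))"
      using small_parameter[OF a] True R
      by (intro ennreal_leI symmetrized_weight_le) (auto simp: A1_def A2_def s_def d_def)
    finally show ?thesis using True by (simp add: ennreal_mult)
  next
    case False
    then have "q \<notin> C \<or> p \<notin> C \<and> - p \<notin> C" using sym[of "- p"] by auto
    then show ?thesis by (auto simp: P_def)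
  qed
  have "2 * (\<integral>\<^sup>+p. \<integral>\<^sup>+q. P p q \<partial>lborel \<partial>lborel) = (\<integral>\<^sup>+p. \<integral>\<^sup>+q. P p q \<partial>lborel \<partial>lborel) + (\<integral>\<^sup>+p. \<integral>\<^sup>+q. P (- p) q \<partial>lborel \<partial>lborel)"
    unfolding refl[symmetric] by (simp add: mult_2)
  also have "\<dots> = (\<integral>\<^sup>+p. \<integral>\<^sup>+q. P p q + P (- p) q \<partial>lborel \<partial>lborel)"
    unfolding P_def by (subst nn_integral_add[symmetric], measurable, subst nn_integral_add[symmetric], measurable)
  also have "\<dots> \<le> (\<integral>\<^sup>+p. \<integral>\<^sup>+q. 2 * (ennreal (exp (- ((norm p)\<^sup>2 + (norm q)\<^sup>2) / 2)) * (indicator C p * indicator C q)) \<partial>lborel \<partial>lborel)"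
    by (intro nn_integral_mono sum)
  also have "\<dots> = 2 * (gauss_mass C * gauss_mass C)"
    by (subst gauss_mass_prod_integral, measurable, subst nn_integral_cmult, measurable, subst nn_integral_cmult, measurable)
  finally have "(\<integral>\<^sup>+p. \<integral>\<^sup>+q. P p q \<partial>lborel \<partial>lborel) \<le> gauss_mass C * gauss_mass C"
    by (subst (asm) ennreal_mult_le_mult_iff) auto
  with main show ?thesis by (simp add: power2_eq_square d_def)
qed

section \<open>Finiteness and scaling of the Gaussian integral\<close>

text \<open>From \<open>(\<bar>t\<bar> - 1)^2 \<ge> 0\<close> the integrand is at most
  \<open>exp (1/2) * exp (- \<bar>t\<bar>)\<close>, whose two halves have explicit
  integrals.\<close>

lemma nn_integral_exp_half_square_finite: "(\<integral>\<^sup>+t. ennreal (exp (- t\<^sup>2 / 2)) \<partial>lborel) < top"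
proof -
  have 1: "(\<integral>\<^sup>+t. ennreal (exp (- t)) * indicator {0..} t \<partial>lborel) = ennreal (0 - (- exp (- 0)))"
  proof (rule nn_integral_FTC_atLeast)
    have "((\<lambda>t::real. exp (- t)) \<longlongrightarrow> 0) at_top"
      by (rule filterlim_compose[OF exp_at_bot filterlim_uminus_at_bot_at_top])
    from tendsto_minus[OF this] show "((\<lambda>t::real. - exp (- t)) \<longlongrightarrow> 0) at_top" by simp
  qed (auto intro!: derivative_eq_intros)
  have 2: "(\<integral>\<^sup>+t. ennreal (exp (- (- t))) * indicator {0..} (- t) \<partial>lborel)
      = (\<integral>\<^sup>+t. ennreal (exp (- t)) * indicator {0..} t \<partial>lborel)"
    using nn_integral_real_affine[of "\<lambda>t. ennreal (exp (- t)) * indicator {0..} t" "-1" 0] by simp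
  have "(\<integral>\<^sup>+t. ennreal (exp (- t\<^sup>2 / 2)) \<partial>lborel)
      \<le> (\<integral>\<^sup>+t. ennreal (exp (1/2)) * (ennreal (exp (- t)) * indicator {0..} t +
          ennreal (exp (- (- t))) * indicator {0..} (- t)) \<partial>lborel)"
  proof (intro nn_integral_mono)
    fix t :: real
    have "0 \<le> (\<bar>t\<bar> - 1)\<^sup>2" by simp
    then have "- t\<^sup>2 / 2 \<le> 1/2 - \<bar>t\<bar>" by (simp add: power2_diff)
    then have "exp (- t\<^sup>2 / 2) \<le> exp (1/2) * exp (- \<bar>t\<bar>)" by (simp flip: exp_add)
    then have le: "ennreal (exp (- t\<^sup>2 / 2)) \<le> ennreal (exp (1/2)) * ennreal (exp (- \<bar>t\<bar>))"
      by (simp add: ennreal_mult[symmetric] ennreal_leI)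
    also have "\<dots> \<le> ennreal (exp (1/2)) * (ennreal (exp (- t)) * indicator {0..} t +
          ennreal (exp (- (- t))) * indicator {0..} (- t))"
      by (intro mult_left_mono) (auto simp: indicator_def)
    finally show "ennreal (exp (- t\<^sup>2 / 2)) \<le> ennreal (exp (1/2)) * (ennreal (exp (- t)) * indicator {0..} t +
          ennreal (exp (- (- t))) * indicator {0..} (- t))" .
  qed
  also have "\<dots> = ennreal (exp (1/2)) * ((\<integral>\<^sup>+t. ennreal (exp (- t)) * indicator {0..} t \<partial>lborel)
      + (\<integral>\<^sup>+t. ennreal (exp (- (- t))) * indicator {0..} (- t) \<partial>lborel))"
    by (subst nn_integral_cmult, measurable, subst nn_integral_add, measurable)
  also have "\<dots> < top" unfolding 2 1 by (simp add: ennreal_mult_less_top)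
  finally show ?thesis .
qed

lemma gauss_mass_mono: "A \<subseteq> B \<Longrightarrow> gauss_mass A \<le> gauss_mass B"
  unfolding gauss_mass_def by (intro nn_integral_mono mult_left_mono) (auto simp: indicator_def)

text \<open>On the whole space the integrand factors over the coordinates into one-dimensional
  Gaussians.\<close>

lemma gauss_mass_finite: "gauss_mass A < top" for A :: "'a::euclidean_space set"
proof -
  have "gauss_mass A \<le> gauss_mass (UNIV :: 'a set)" by (rule gauss_mass_mono) simp
  also have "\<dots> = (\<integral>\<^sup>+x. (\<Prod>b\<in>Basis. ennreal (exp (- (x \<bullet> b)\<^sup>2 / 2))) \<partial>(lborel :: 'a measure))"
  proof -
    have "ennreal (exp (- (norm x)\<^sup>2 / 2)) = (\<Prod>b\<in>Basis. ennreal (exp (- (x \<bullet> b)\<^sup>2 / 2)))" for x :: 'a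
    proof -
      have "- (norm x)\<^sup>2 / 2 = (\<Sum>b\<in>Basis. - (x \<bullet> b)\<^sup>2 / 2)"
        unfolding power2_norm_eq_inner euclidean_inner[of x x]
        by (simp add: power2_eq_square sum_negf flip: sum_divide_distrib)
      then show ?thesis by (simp add: exp_sum prod_ennreal)
    qed
    then show ?thesis by (simp add: gauss_mass_def)
  qed
  also have "\<dots> = (\<Prod>b\<in>(Basis :: 'a set). (\<integral>\<^sup>+t. ennreal (exp (- t\<^sup>2 / 2)) \<partial>lborel))"
    by (rule nn_integral_lborel_prod) auto
  also have "\<dots> < top"
    using nn_integral_exp_half_square_finite by (simp add: power_less_top_ennreal)
  finally show ?thesis .
qed

text \<open>The density is positive, so mass 0 would make a nonempty open set negligible.\<close>

lemma gauss_mass_pos: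
  fixes S :: "'a::euclidean_space set"
  assumes "open S" "S \<noteq> {}"
  shows "0 < gauss_mass S"
proof (rule ccontr)
  assume "\<not> 0 < gauss_mass S"
  then have z: "(\<integral>\<^sup>+x. ennreal (exp (- (norm x)\<^sup>2 / 2)) * indicator S x \<partial>lborel) = 0"
    by (simp add: gauss_mass_def)
  have [measurable]: "S \<in> sets borel" using assms by simp
  have "AE x in lborel. ennreal (exp (- (norm x)\<^sup>2 / 2)) * indicator S x = 0"
    using z by (subst (asm) nn_integral_0_iff_AE) auto
  then have "AE x in lborel. x \<notin> S"
    by eventually_elim (auto simp: indicator_def split: if_splits)
  then have "S \<in> null_sets lborel" by (simp add: AE_iff_null_sets)
  then have "negligible S" by (metis negligible_iff_null_sets null_sets_completionI)
  then show False using assms open_not_negligible by blast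
qed

text \<open>The contraction has Jacobian \<open>c ^ DIM('a)\<close>, and moving points towards the
  origin only raises the density. It serves to compare nearby combinations and to treat sets with
  empty interior.\<close>

lemma gauss_mass_scale:
  fixes S :: "'a::euclidean_space set"
  assumes "S \<in> sets borel" "0 < c" "c \<le> 1"
    and T: "T \<in> sets borel" "\<And>x. x \<in> S \<Longrightarrow> c *\<^sub>R x \<in> T"
  shows "ennreal (c ^ DIM('a)) * gauss_mass S \<le> gauss_mass T"
proof -
  note [measurable] = assms(1) T(1)
  have "gauss_mass T = ennreal (c ^ DIM('a)) * (\<integral>\<^sup>+x. ennreal (exp (- (norm (c *\<^sub>R x))\<^sup>2 / 2)) * indicator T (c *\<^sub>R x) \<partial>lborel)"
    unfolding gauss_mass_def using assms(2)
    by (subst nn_integral_lborel_affine[where c = c and t = 0]) auto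
  also have "\<dots> \<ge> ennreal (c ^ DIM('a)) * gauss_mass S"
    unfolding gauss_mass_def
  proof (intro mult_left_mono nn_integral_mono)
    fix x :: 'a
    have "norm (c *\<^sub>R x) \<le> norm x" using assms by (simp add: mult_left_le_one_le)
    then have "(norm (c *\<^sub>R x))\<^sup>2 \<le> (norm x)\<^sup>2" by (intro power_mono) auto
    then show "ennreal (exp (- (norm x)\<^sup>2 / 2)) * indicator S x
        \<le> ennreal (exp (- (norm (c *\<^sub>R x))\<^sup>2 / 2)) * indicator T (c *\<^sub>R x)"
      using T(2)[of x] by (auto simp: indicator_def intro!: ennreal_leI)
  qed simp
  finally show ?thesis .
qed

section \<open>Gaussian mass as a real number\<close>

definition gauss_vol :: "'a::euclidean_space set \<Rightarrow> real" where "gauss_vol S = enn2real (gauss_mass S)"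

lemma gauss_mass_eq_gauss_vol: "gauss_mass S = ennreal (gauss_vol S)"
  using gauss_mass_finite[of S] by (simp add: gauss_vol_def)

lemma gauss_vol_nonneg: "0 \<le> gauss_vol S"
  by (simp add: gauss_vol_def)

lemma gauss_vol_pos: "open S \<Longrightarrow> S \<noteq> {} \<Longrightarrow> 0 < gauss_vol S"
  using gauss_mass_pos[of S] by (simp add: gauss_mass_eq_gauss_vol)

lemma gauss_vol_mono: "A \<subseteq> B \<Longrightarrow> gauss_vol A \<le> gauss_vol B"
  using gauss_mass_mono[of A B] by (simp add: gauss_mass_eq_gauss_vol gauss_vol_nonneg)

lemma gauss_vol_scale:
  fixes S :: "'a::euclidean_space set"
  assumes "S \<in> sets borel" "0 < c" "c \<le> 1" "T \<in> sets borel" "\<And>x. x \<in> S \<Longrightarrow> c *\<^sub>R x \<in> T"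
  shows "c ^ DIM('a) * gauss_vol S \<le> gauss_vol T"
  using gauss_mass_scale[OF assms] assms(2)
  by (simp add: gauss_mass_eq_gauss_vol gauss_vol_nonneg ennreal_mult[symmetric] ennreal_le_iff)

lemma gauss_vol_midpoint:
  fixes A B C :: "'a::euclidean_space set" and a :: real
  assumes "A \<in> sets borel" "B \<in> sets borel" "C \<in> sets borel"
    and "\<And>x y. x \<in> A \<Longrightarrow> y \<in> B \<Longrightarrow> (1/2) *\<^sub>R ((1 + a) *\<^sub>R x + (1 - a) *\<^sub>R y) \<in> C"
    and "\<And>x. x \<in> C \<Longrightarrow> - x \<in> C"
    and "\<And>x. x \<in> C \<Longrightarrow> norm x \<le> R"
    and "a\<^sup>2 \<le> 1 / 4" "a\<^sup>2 * (8 * R\<^sup>2) \<le> 1"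
  shows "(1 - a\<^sup>2) ^ DIM('a) * (gauss_vol A * gauss_vol B) \<le> (gauss_vol C)\<^sup>2"
  using gauss_mass_midpoint[OF assms] assms(7)
  by (simp add: gauss_mass_eq_gauss_vol gauss_vol_nonneg ennreal_mult[symmetric] ennreal_power ennreal_le_iff)

section \<open>Minkowski combinations of symmetric convex sets\<close>

text \<open>The same set as \<open>minkowski_comb\<close>, over an arbitrary real vector
  space.\<close>

definition set_comb :: "real \<Rightarrow> 'a::real_vector set \<Rightarrow> 'a set \<Rightarrow> 'a set" where
  "set_comb t K L = {t *\<^sub>R a + (1 - t) *\<^sub>R b | a b. a \<in> K \<and> b \<in> L}"

text \<open>Normalize the weights by \<open>p + q\<close>. The form without division also covers
  \<open>p + q = 0\<close>, which occurs when an end point of the parameter interval is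
  involved.\<close>

lemma convex_combine:
  assumes "convex K" "x \<in> K" "y \<in> K" "0 \<le> p" "0 \<le> q"
  shows "\<exists>z\<in>K. p *\<^sub>R x + q *\<^sub>R y = (p + q) *\<^sub>R z"
proof (cases "p + q = 0")
  case True
  then have "p = 0" "q = 0" using assms by auto
  then show ?thesis using assms by auto
next
  case False
  have "(p / (p + q)) *\<^sub>R x + (q / (p + q)) *\<^sub>R y \<in> K"
    using False assms by (intro convexD) (auto simp: add_divide_distrib[symmetric])
  moreover have "p *\<^sub>R x + q *\<^sub>R y = (p + q) *\<^sub>R ((p / (p + q)) *\<^sub>R x + (q / (p + q)) *\<^sub>R y)"
    using False by (simp add: scaleR_add_right)
  ultimately show ?thesis by blast
qed

text \<open>Collect the two points of \<open>K\<close> and the two points of \<open>L\<close>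
  separately; convexity merges each pair, and the total weights add up to 1.\<close>

lemma set_comb_combine:
  assumes "convex K" "convex L" "x \<in> set_comb t1 K L" "y \<in> set_comb t2 K L"
    and "0 \<le> p" "0 \<le> q" "p + q = 1" "0 \<le> t1" "t1 \<le> 1" "0 \<le> t2" "t2 \<le> 1"
  shows "p *\<^sub>R x + q *\<^sub>R y \<in> set_comb (p * t1 + q * t2) K L"
proof -
  obtain k1 l1 k2 l2 where *: "k1 \<in> K" "l1 \<in> L" "k2 \<in> K" "l2 \<in> L"
    "x = t1 *\<^sub>R k1 + (1 - t1) *\<^sub>R l1" "y = t2 *\<^sub>R k2 + (1 - t2) *\<^sub>R l2"
    using assms(3,4) by (auto simp: set_comb_def)
  obtain k where k: "k \<in> K" "(p * t1) *\<^sub>R k1 + (q * t2) *\<^sub>R k2 = (p * t1 + q * t2) *\<^sub>R k"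
    using convex_combine[OF assms(1) *(1,3), of "p * t1" "q * t2"] assms by auto
  obtain l where l: "l \<in> L" "(p * (1 - t1)) *\<^sub>R l1 + (q * (1 - t2)) *\<^sub>R l2 = (p * (1 - t1) + q * (1 - t2)) *\<^sub>R l"
    using convex_combine[OF assms(2) *(2,4), of "p * (1 - t1)" "q * (1 - t2)"] assms by auto
  have e: "p * (1 - t1) + q * (1 - t2) = 1 - (p * t1 + q * t2)"
    using assms(7) by (simp add: algebra_simps)
  have "p *\<^sub>R x + q *\<^sub>R y = ((p * t1) *\<^sub>R k1 + (q * t2) *\<^sub>R k2) + ((p * (1 - t1)) *\<^sub>R l1 + (q * (1 - t2)) *\<^sub>R l2)"
    unfolding * by (simp add: scaleR_add_right)
  also have "\<dots> = (p * t1 + q * t2) *\<^sub>R k + (1 - (p * t1 + q * t2)) *\<^sub>R l"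
    unfolding k(2) l(2) e ..
  finally show ?thesis using k l unfolding set_comb_def by blast
qed

lemma convex_comb: "convex K \<Longrightarrow> convex L \<Longrightarrow> 0 \<le> t \<Longrightarrow> t \<le> 1 \<Longrightarrow> convex (set_comb t K L)"
  unfolding convex_def
proof (intro ballI allI impI, goal_cases)
  case (1 x y u v)
  then have "u *\<^sub>R x + v *\<^sub>R y \<in> set_comb (u * t + v * t) K L"
    by (intro set_comb_combine) (auto simp: convex_def)
  moreover have "u * t + v * t = t" using 1 by (simp flip: distrib_right)
  ultimately show ?case by simp
qed

text \<open>One of \<open>t\<close> and \<open>1 - t\<close> is nonzero, so one summand is open, and
  an open set plus any set is open.\<close>

lemma open_comb:
  fixes K L :: "'a::real_normed_vector set"
  assumes "open K" "open L" "K \<noteq> {}" "L \<noteq> {}"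
  shows "open (set_comb t K L)"
proof -
  have "set_comb t K L = (\<Union>x\<in>(\<lambda>x. t *\<^sub>R x) ` K. \<Union>y\<in>(\<lambda>x. (1 - t) *\<^sub>R x) ` L. {x + y})"
    by (auto simp: set_comb_def)
  moreover have "open ((\<lambda>x. t *\<^sub>R x) ` K) \<or> open ((\<lambda>x. (1 - t) *\<^sub>R x) ` L)"
    using assms by (cases "t = 0") (auto intro: open_scaling)
  ultimately show ?thesis using open_sums by metis
qed

lemma set_comb_0: "K \<noteq> {} \<Longrightarrow> set_comb 0 K L = L" and set_comb_1: "L \<noteq> {} \<Longrightarrow> set_comb 1 K L = K"
  by (auto simp: set_comb_def)

lemma set_comb_uminus:
  assumes "\<And>x. x \<in> K \<Longrightarrow> - x \<in> K" "\<And>x. x \<in> L \<Longrightarrow> - x \<in> L" "x \<in> set_comb t K L"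
  shows "- x \<in> set_comb t K L"
proof -
  obtain a b where "a \<in> K" "b \<in> L" "x = t *\<^sub>R a + (1 - t) *\<^sub>R b" using assms(3) by (auto simp: set_comb_def)
  then have "- x = t *\<^sub>R (- a) + (1 - t) *\<^sub>R (- b)" "- a \<in> K" "- b \<in> L" using assms by auto
  then show ?thesis unfolding set_comb_def by blast
qed

lemma set_comb_norm_le:
  assumes "\<And>x. x \<in> K \<Longrightarrow> norm x \<le> R" "\<And>x. x \<in> L \<Longrightarrow> norm x \<le> R" "x \<in> set_comb t K L" "0 \<le> t" "t \<le> 1"
  shows "norm x \<le> R"
proof -
  obtain a b where ab: "a \<in> K" "b \<in> L" "x = t *\<^sub>R a + (1 - t) *\<^sub>R b" using assms(3) by (auto simp: set_comb_def)
  have "norm x \<le> t * norm a + (1 - t) * norm b"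
    unfolding ab using norm_triangle_ineq[of "t *\<^sub>R a" "(1 - t) *\<^sub>R b"] assms by simp
  also have "\<dots> \<le> t * R + (1 - t) * R" using assms ab by (intro add_mono mult_left_mono) auto
  finally show ?thesis by (simp add: algebra_simps)
qed

text \<open>Changing the parameter moves \<open>x\<close> by \<open>(u - t) (a - b)\<close>, of norm
  at most \<open>2 R \<bar>u - t\<bar>\<close>. With this \<open>\<delta>\<close> the shift is
  \<open>\<delta> z\<close> with \<open>norm z \<le> r / 2\<close>, so \<open>z\<close> lies in the
  open ball common to \<open>K\<close> and \<open>L\<close>, and \<open>x / (1 + \<delta>)\<close>
  is a convex combination of \<open>y\<close> and \<open>z\<close>.\<close>

lemma set_comb_dilate:
  fixes K L :: "'a::real_normed_vector set"
  assumes "convex K" "convex L" and r: "0 < r" "ball 0 r \<subseteq> K" "ball 0 r \<subseteq> L"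
    and R: "\<And>x. x \<in> K \<Longrightarrow> norm x \<le> R" "\<And>x. x \<in> L \<Longrightarrow> norm x \<le> R"
    and t: "0 \<le> t" "t \<le> 1" and x: "x \<in> set_comb u K L"
    and d: "\<delta> = 4 * R / r * \<bar>u - t\<bar>" and R0: "0 < R"
  shows "(1 / (1 + \<delta>)) *\<^sub>R x \<in> set_comb t K L"
proof -
  have d0: "0 \<le> \<delta>" using r R0 by (simp add: d)
  obtain a b where ab: "a \<in> K" "b \<in> L" "x = u *\<^sub>R a + (1 - u) *\<^sub>R b" using x by (auto simp: set_comb_def)
  define y where "y = t *\<^sub>R a + (1 - t) *\<^sub>R b"
  have y: "y \<in> set_comb t K L" using ab by (auto simp: set_comb_def y_def)
  have xy: "x - y = (u - t) *\<^sub>R (a - b)" by (simp add: ab y_def algebra_simps)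
  show ?thesis
  proof (cases "u = t")
    case True
    then show ?thesis using x d by simp
  next
    case False
    then have dp: "0 < \<delta>" using r R0 by (simp add: d)
    define z where "z = (1 / \<delta>) *\<^sub>R (x - y)"
    have "norm (a - b) \<le> 2 * R" using norm_triangle_ineq4[of a b] R ab by fastforce
    then have "norm (x - y) \<le> \<bar>u - t\<bar> * (2 * R)" unfolding xy by (simp add: mult_left_mono)
    also have "\<dots> = \<delta> * (r / 2)" using r by (simp add: d)
    finally have "norm (x - y) / \<delta> \<le> r / 2" using dp by (simp add: divide_le_eq mult.commute)
    then have "norm z \<le> r / 2" using dp unfolding z_def norm_scaleR by simp
    then have "z \<in> ball 0 r" using r by simp
    then have "z \<in> K" "z \<in> L" using r by auto
    moreover have "z = t *\<^sub>R z + (1 - t) *\<^sub>R z" by (simp flip: scaleR_add_left)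
    ultimately have "z \<in> set_comb t K L" unfolding set_comb_def by blast
    then have "(1 / (1 + \<delta>)) *\<^sub>R y + (\<delta> / (1 + \<delta>)) *\<^sub>R z \<in> set_comb t K L"
      using y d0 convex_comb[OF assms(1,2) t] by (intro convexD) (auto simp: add_divide_distrib[symmetric])
    moreover have "\<delta> *\<^sub>R z = x - y" using dp by (simp add: z_def)
    then have "(\<delta> / (1 + \<delta>)) *\<^sub>R z = (1 / (1 + \<delta>)) *\<^sub>R (x - y)" by (metis divide_inverse mult.commute mult_1 scaleR_scaleR)
    ultimately show ?thesis by (simp add: scaleR_diff_right)
  qed
qed

text \<open>Dilation in both directions between the parameters \<open>u\<close> and \<open>t\<close>
  squeezes the volume at \<open>u\<close> between multiples of the volume at \<open>t\<close> whose
  factors tend to 1.\<close>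

lemma continuous_gauss_vol_comb:
  fixes K L :: "'a::euclidean_space set"
  assumes cv: "convex K" "convex L" and op: "open K" "open L" and r: "0 < r" "ball 0 r \<subseteq> K" "ball 0 r \<subseteq> L"
    and R: "\<And>x. x \<in> K \<Longrightarrow> norm x \<le> R" "\<And>x. x \<in> L \<Longrightarrow> norm x \<le> R" "0 < R"
  shows "continuous_on {0..1} (\<lambda>t. gauss_vol (set_comb t K L))"
  unfolding continuous_on_def
proof
  fix t :: real assume t: "t \<in> {0..1}"
  have ne: "K \<noteq> {}" "L \<noteq> {}" using r by auto
  have borel: "set_comb u K L \<in> sets borel" for u using open_comb[OF op ne] by simp
  define \<delta> where "\<delta> u = 4 * R / r * \<bar>u - t\<bar>" for u
  have d0: "0 \<le> \<delta> u" for u using r R by (simp add: \<delta>_def)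
  have lim: "(\<delta> \<longlongrightarrow> 0) (at t within {0..1})"
    unfolding \<delta>_def by (rule tendsto_eq_intros refl | simp)+
  have bound: "(1 / (1 + \<delta> u)) ^ DIM('a) * gauss_vol (set_comb v K L) \<le> gauss_vol (set_comb w K L)"
    if "(v = u \<and> w = t) \<or> (v = t \<and> w = u)" "u \<in> {0..1}" for u v w
  proof (rule gauss_vol_scale)
    fix x assume "x \<in> set_comb v K L"
    then show "(1 / (1 + \<delta> u)) *\<^sub>R x \<in> set_comb w K L"
      using t that by (intro set_comb_dilate[OF cv r R(1,2), of w x v]) (auto simp: \<delta>_def R(3) abs_minus_commute)
  qed (use d0[of u] borel in auto)
  have e1: "\<forall>\<^sub>F u in at t within {0..1}. u \<in> {0..1}"
    by (simp add: eventually_at_filter)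
  show "((\<lambda>u. gauss_vol (set_comb u K L)) \<longlongrightarrow> gauss_vol (set_comb t K L)) (at t within {0..1})"
  proof (rule tendsto_sandwich)
    show "\<forall>\<^sub>F u in at t within {0..1}. (1 / (1 + \<delta> u)) ^ DIM('a) * gauss_vol (set_comb t K L) \<le> gauss_vol (set_comb u K L)"
      using e1 by eventually_elim (rule bound, auto)
    show "\<forall>\<^sub>F u in at t within {0..1}. gauss_vol (set_comb u K L) \<le> (1 + \<delta> u) ^ DIM('a) * gauss_vol (set_comb t K L)"
      using e1
    proof eventually_elim
      case (elim u)
      have "0 < 1 + \<delta> u" using d0[of u] by simp
      then show ?case using bound[of u u t] elim by (simp add: power_divide field_simps)
    qed
    show "((\<lambda>u. (1 / (1 + \<delta> u)) ^ DIM('a) * gauss_vol (set_comb t K L)) \<longlongrightarrow> gauss_vol (set_comb t K L)) (at t within {0..1})"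
      by (rule tendsto_eq_intros lim refl | simp)+
    show "((\<lambda>u. (1 + \<delta> u) ^ DIM('a) * gauss_vol (set_comb t K L)) \<longlongrightarrow> gauss_vol (set_comb t K L)) (at t within {0..1})"
      by (rule tendsto_eq_intros lim refl | simp)+
  qed
qed

text \<open>The set of minimizers is closed, so it has a least element. Strictness to its left is
  what later turns a non-strict midpoint inequality into a contradiction.\<close>

lemma continuous_first_minimum:
  fixes Q :: "real \<Rightarrow> real"
  assumes cont: "continuous_on {0..1} Q"
  obtains t0 where "t0 \<in> {0..1}" "\<And>t. t \<in> {0..1} \<Longrightarrow> Q t0 \<le> Q t" "\<And>t. 0 \<le> t \<Longrightarrow> t < t0 \<Longrightarrow> Q t0 < Q t"
proof -
  obtain s0 where s0: "s0 \<in> {0..1}" "\<And>t. t \<in> {0..1} \<Longrightarrow> Q s0 \<le> Q t"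
    using continuous_attains_inf[OF compact_Icc _ cont] by auto
  define Z where "Z = {0..1} \<inter> Q -` {..Q s0}"
  have "closed Z" unfolding Z_def by (intro continuous_closed_preimage cont) auto
  moreover have "Z \<noteq> {}" "bdd_below Z" using s0 by (auto simp: Z_def)
  ultimately have Z: "Inf Z \<in> Z" by (intro closed_contains_Inf)
  show ?thesis
  proof (rule that[of "Inf Z"])
    show "Inf Z \<in> {0..1}" using Z by (auto simp: Z_def)
    show "Q (Inf Z) \<le> Q t" if "t \<in> {0..1}" for t using Z s0(2)[OF that] by (auto simp: Z_def)
    show "Q (Inf Z) < Q t" if "0 \<le> t" "t < Inf Z" for t
    proof (rule ccontr)
      assume "\<not> ?thesis"
      then have "t \<in> Z" using Z that by (auto simp: Z_def)
      then show False using that cInf_lower[OF _ \<open>bdd_below Z\<close>, of t] by simp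
    qed
  qed
qed

text \<open>The inner radius \<open>r\<close> provides continuity in the parameter, the outer radius
  \<open>R\<close> makes the midpoint inequality available for small \<open>a\<close>. The numbers
  \<open>\<alpha>\<close> and \<open>\<beta>\<close> are the roots of the end volumes, so the
  quotient \<open>Q\<close> equals 1 at both ends.\<close>

lemma gauss_vol_comb_open:
  fixes K L :: "'a::euclidean_space set"
  assumes cv: "convex K" "convex L" and op: "open K" "open L" and r: "0 < r" "ball 0 r \<subseteq> K" "ball 0 r \<subseteq> L"
    and R: "\<And>x. x \<in> K \<Longrightarrow> norm x \<le> R" "\<And>x. x \<in> L \<Longrightarrow> norm x \<le> R" "0 < R"
    and sym: "\<And>x. x \<in> K \<Longrightarrow> - x \<in> K" "\<And>x. x \<in> L \<Longrightarrow> - x \<in> L"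
    and t: "0 \<le> t" "t \<le> 1"
    and \<alpha>: "0 < \<alpha>" "\<alpha> ^ DIM('a) = gauss_vol K" and \<beta>: "0 < \<beta>" "\<beta> ^ DIM('a) = gauss_vol L"
  shows "(t * \<alpha> + (1 - t) * \<beta>) ^ DIM('a) \<le> gauss_vol (set_comb t K L)"
proof -
  let ?n = "DIM('a)"
  have ne: "K \<noteq> {}" "L \<noteq> {}" using r by auto
  have borel: "set_comb u K L \<in> sets borel" for u using open_comb[OF op ne] by simp
  have pos: "0 < gauss_vol (set_comb u K L)" for u
    using open_comb[OF op ne] ne by (intro gauss_vol_pos) (auto simp: set_comb_def)
  define l where "l u = u * \<alpha> + (1 - u) * \<beta>" for u
  have l: "0 < l u" if "u \<in> {0..1}" for u
  proof (cases "u = 0")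
    case False
    then have "0 < u * \<alpha>" "0 \<le> (1 - u) * \<beta>" using that \<alpha> \<beta> by auto
    then show ?thesis by (simp add: l_def)
  qed (use \<beta> in \<open>simp add: l_def\<close>)
  define Q where "Q u = gauss_vol (set_comb u K L) / l u ^ ?n" for u
  have "continuous_on {0..1} Q"
    unfolding Q_def
    by (intro continuous_on_divide continuous_gauss_vol_comb[OF cv op r R] continuous_on_power)
       (auto simp: l_def intro!: continuous_intros dest: l[unfolded l_def])
  then obtain t0 where t0: "t0 \<in> {0..1}" "\<And>t. t \<in> {0..1} \<Longrightarrow> Q t0 \<le> Q t" "\<And>t. 0 \<le> t \<Longrightarrow> t < t0 \<Longrightarrow> Q t0 < Q t"
    using continuous_first_minimum by metis
  have "1 \<le> Q t0"
  proof (rule ccontr)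
    assume "\<not> 1 \<le> Q t0"
    \<comment> \<open>A minimum below 1 is therefore interior.\<close>
    moreover have "Q 0 = 1" "Q 1 = 1"
      using \<alpha> \<beta> pos[of 0] pos[of 1] ne by (auto simp: Q_def set_comb_0 set_comb_1 l_def)
    ultimately have t01: "0 < t0" "t0 < 1" using t0(1) by (auto simp: le_less)
    define m l0 where "m = \<alpha> - \<beta>" and "l0 = l t0"
    have l0: "0 < l0" using l[OF t0(1)] by (simp add: l0_def)
    \<comment> \<open>With \<open>m\<close> the slope of \<open>l\<close>, this makes both
      \<open>(1 + a) l(t+)\<close> and \<open>(1 - a) l(t-)\<close> equal to \<open>l0\<close>, so
      the factor \<open>1 - a^2\<close> cancels exactly.\<close>
    define a where "a s = - m * s / l0" for s
    have lima: "(a \<longlongrightarrow> 0) (at_right 0)"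
      unfolding a_def by (rule tendsto_eq_intros refl | use l0 in simp)+
    have "((\<lambda>s. (a s)\<^sup>2) \<longlongrightarrow> 0) (at_right 0)" by (rule tendsto_eq_intros lima refl | simp)+
    then have "\<forall>\<^sub>F s in at_right 0. (a s)\<^sup>2 < 1 / 4" by (rule order_tendstoD) simp
    moreover have "((\<lambda>s. (a s)\<^sup>2 * (8 * R\<^sup>2)) \<longlongrightarrow> 0) (at_right 0)" by (rule tendsto_eq_intros lima refl | simp)+
    then have "\<forall>\<^sub>F s in at_right 0. (a s)\<^sup>2 * (8 * R\<^sup>2) < 1" by (rule order_tendstoD) simp
    moreover have "((\<lambda>s. t0 + s / (1 + a s)) \<longlongrightarrow> t0) (at_right 0)" by (rule tendsto_eq_intros lima refl | simp)+
    then have "\<forall>\<^sub>F s in at_right 0. t0 + s / (1 + a s) < 1" using t01(2) by (rule order_tendstoD)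
    moreover have "((\<lambda>s. t0 - s / (1 - a s)) \<longlongrightarrow> t0) (at_right 0)" by (rule tendsto_eq_intros lima refl | simp)+
    then have "\<forall>\<^sub>F s in at_right 0. 0 < t0 - s / (1 - a s)" using t01(1) by (rule order_tendstoD)
    moreover have "\<forall>\<^sub>F s in at_right (0::real). 0 < s" by (rule eventually_at_right_less)
    ultimately have "\<forall>\<^sub>F s in at_right 0. (a s)\<^sup>2 < 1 / 4 \<and> (a s)\<^sup>2 * (8 * R\<^sup>2) < 1 \<and>
        t0 + s / (1 + a s) < 1 \<and> 0 < t0 - s / (1 - a s) \<and> 0 < s"
      by eventually_elim simp
    then obtain s where s: "(a s)\<^sup>2 < 1 / 4" "(a s)\<^sup>2 * (8 * R\<^sup>2) < 1"
        "t0 + s / (1 + a s) < 1" "0 < t0 - s / (1 - a s)" "0 < s"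
      using eventually_happens'[OF trivial_limit_at_right_real] by (metis (no_types, lifting))
    define b where "b = a s"
    \<comment> \<open>The weights \<open>(1 + b) / 2\<close> and \<open>(1 - b) / 2\<close> average
      these two parameters to \<open>t0\<close>.\<close>
    define tp tm where "tp = t0 + s / (1 + b)" and "tm = t0 - s / (1 - b)"
    have "\<bar>b\<bar> < 1 / 2" using s(1) abs_square_less_1[of "2 * b"] by (simp add: b_def power2_eq_square)
    then have b: "0 < 1 + b" "0 < 1 - b" by auto
    have tp: "t0 < tp" "tp < 1" "(1 + b) * tp = (1 + b) * t0 + s"
      using s b by (auto simp: tp_def b_def[symmetric] distrib_left)
    have tm: "tm < t0" "0 < tm" "(1 - b) * tm = (1 - b) * t0 - s"
      using s b by (auto simp: tm_def b_def[symmetric] right_diff_distrib)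
    have mid: "(1 - b\<^sup>2) ^ ?n * (gauss_vol (set_comb tp K L) * gauss_vol (set_comb tm K L)) \<le> (gauss_vol (set_comb t0 K L))\<^sup>2"
    proof (rule gauss_vol_midpoint[where R = R])
      fix x y assume "x \<in> set_comb tp K L" "y \<in> set_comb tm K L"
      then have "((1 + b) / 2) *\<^sub>R x + ((1 - b) / 2) *\<^sub>R y \<in> set_comb ((1 + b) / 2 * tp + (1 - b) / 2 * tm) K L"
        using b tp tm t01 by (intro set_comb_combine[OF cv]) (auto simp: add_divide_distrib[symmetric])
      moreover have "(1 + b) / 2 * tp + (1 - b) / 2 * tm = t0"
        using tp(3) tm(3) by (simp add: field_simps)
      ultimately show "(1/2) *\<^sub>R ((1 + b) *\<^sub>R x + (1 - b) *\<^sub>R y) \<in> set_comb t0 K L"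
        by (simp add: scaleR_add_right)
    next
      show "- x \<in> set_comb t0 K L" if "x \<in> set_comb t0 K L" for x
        using set_comb_uminus[OF sym] that by blast
      show "norm x \<le> R" if "x \<in> set_comb t0 K L" for x
        using set_comb_norm_le[OF R(1,2) that] t01 by simp
    qed (use borel s in \<open>auto simp: b_def\<close>)
    have lin: "l u = l0 + m * (u - t0)" for u
      by (simp add: l_def l0_def m_def algebra_simps)
    have ms: "m * s = - b * l0" using l0 by (simp add: b_def a_def)
    have "(1 + b) * l tp = (1 + b) * l0 + m * ((1 + b) * tp - (1 + b) * t0)"
      unfolding lin by (simp add: algebra_simps)
    also have "\<dots> = l0" unfolding tp(3) using ms by (simp add: algebra_simps)
    finally have lp: "(1 + b) * l tp = l0" .
    have "(1 - b) * l tm = (1 - b) * l0 + m * ((1 - b) * tm - (1 - b) * t0)"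
      unfolding lin by (simp add: algebra_simps)
    also have "\<dots> = l0" unfolding tm(3) using ms by (simp add: algebra_simps)
    finally have lm: "(1 - b) * l tm = l0" .
    have lpm: "(1 - b\<^sup>2) * (l tp * l tm) = l0 * l0"
    proof -
      have "(1 - b\<^sup>2) * (l tp * l tm) = ((1 + b) * l tp) * ((1 - b) * l tm)"
        by (simp add: power2_eq_square algebra_simps)
      then show ?thesis unfolding lp lm .
    qed
    have G: "gauss_vol (set_comb u K L) = Q u * l u ^ ?n" if "u \<in> {0..1}" for u
      using l[OF that] by (simp add: Q_def)
    have "(1 - b\<^sup>2) ^ ?n * (gauss_vol (set_comb tp K L) * gauss_vol (set_comb tm K L))
        = (Q tp * Q tm) * ((1 - b\<^sup>2) * (l tp * l tm)) ^ ?n"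
      using tp tm t01 by (simp add: G power_mult_distrib)
    moreover have "(gauss_vol (set_comb t0 K L))\<^sup>2 = (Q t0 * Q t0) * (l0 * l0) ^ ?n"
      using t01 by (simp add: G power_mult_distrib power2_eq_square l0_def)
    ultimately have "Q tp * Q tm \<le> Q t0 * Q t0"
      using mid l0 unfolding lpm by simp
    moreover have Q0: "0 < Q t0" using pos l[OF t0(1)] by (simp add: Q_def)
    \<comment> \<open>Strict because \<open>tm\<close> lies to the left of the first
      minimum.\<close>
    have "Q t0 * Q t0 < Q tp * Q tm"
      using t0(2)[of tp] t0(3)[of tm] Q0 tp tm t01 by (intro mult_le_less_imp_less) auto
    ultimately show False by simp
  qed
  then have "1 \<le> Q t" using t0(2)[of t] t by auto
  then show ?thesis using l[of t] t by (simp add: Q_def l_def[symmetric] le_divide_eq)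
qed

section \<open>The Gaussian measure\<close>

lemma minkowski_comb_eq: "minkowski_comb t K L = set_comb t K L"
  by (simp add: minkowski_comb_def set_comb_def)

definition gauss_const :: "'n::finite itself \<Rightarrow> real" where
  "gauss_const _ = (2 * pi) powr (- real CARD('n) / 2)"

lemma gauss_const_pos: "0 < gauss_const TYPE('n::finite)"
  by (simp add: gauss_const_def)

lemma sets_gaussian [simp]: "sets (gaussian_measure TYPE('n::finite)) = sets lebesgue"
  by (simp add: gaussian_measure_def)

lemma emeasure_gaussian_borel:
  fixes S :: "(real^'n::finite) set"
  assumes [measurable]: "S \<in> sets borel"
  shows "emeasure (gaussian_measure TYPE('n)) S = ennreal (gauss_const TYPE('n) * gauss_vol S)"
proof -
  have [measurable]: "(\<lambda>x::real^'n. ennreal (gauss_const TYPE('n) * exp (- (norm x)\<^sup>2 / 2))) \<in> borel_measurable lborel"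
    by measurable
  have "emeasure (gaussian_measure TYPE('n)) S
      = (\<integral>\<^sup>+x. ennreal (gauss_const TYPE('n) * exp (- (norm x)\<^sup>2 / 2)) * indicator S x \<partial>lebesgue)"
    unfolding gaussian_measure_def gauss_const_def
  proof (rule emeasure_density)
    show "(\<lambda>x::real^'n. ennreal ((2 * pi) powr (- real CARD('n) / 2) * exp (- (norm x)\<^sup>2 / 2))) \<in> borel_measurable lebesgue"
      by (rule measurable_completion) measurable
    show "S \<in> sets lebesgue" using assms by (simp add: sets_completionI_sets)
  qed
  also have "\<dots> = (\<integral>\<^sup>+x. ennreal (gauss_const TYPE('n)) * (ennreal (exp (- (norm x)\<^sup>2 / 2)) * indicator S x) \<partial>lborel)"
    using gauss_const_pos[where 'n = 'n]
    by (simp add: nn_integral_completion ennreal_mult less_imp_le mult.assoc)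
  also have "\<dots> = ennreal (gauss_const TYPE('n)) * gauss_mass S"
    unfolding gauss_mass_def by (rule nn_integral_cmult) measurable
  also have "\<dots> = ennreal (gauss_const TYPE('n) * gauss_vol S)"
    using gauss_const_pos[where 'n = 'n] by (simp add: gauss_mass_eq_gauss_vol ennreal_mult gauss_vol_nonneg)
  finally show ?thesis .
qed

lemma measure_gaussian_borel:
  fixes S :: "(real^'n::finite) set"
  assumes "S \<in> sets borel"
  shows "measure (gaussian_measure TYPE('n)) S = gauss_const TYPE('n) * gauss_vol S"
  using emeasure_gaussian_borel[OF assms] gauss_const_pos[where 'n = 'n]
  by (simp add: measure_def gauss_vol_nonneg)

text \<open>The frontier of a convex set is negligible, hence null for any density. So convex sets
  that need not be Borel are replaced by open ones.\<close>

lemma measure_gaussian_convex: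
  fixes S :: "(real^'n::finite) set"
  assumes "convex S"
  shows "measure (gaussian_measure TYPE('n)) S = gauss_const TYPE('n) * gauss_vol (interior S)"
proof -
  let ?N = "S - interior S"
  have "negligible ?N"
    by (rule negligible_subset[OF negligible_convex_frontier[OF assms]])
       (use closure_subset[of S] in \<open>unfold frontier_def, blast\<close>)
  then have N: "?N \<in> null_sets lebesgue" by (simp add: negligible_iff_null_sets)
  then have N': "?N \<in> null_sets (gaussian_measure TYPE('n))"
    unfolding gaussian_measure_def
  proof (subst null_sets_density_iff, goal_cases)
    case 1
    show ?case by (rule measurable_completion) measurable
  next
    case 2
    have "AE x in lebesgue. x \<in> ?N \<longrightarrow>
        ennreal ((2 * pi) powr (- real CARD('n) / 2) * exp (- (norm x)\<^sup>2 / 2)) = 0"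
      using AE_not_in[OF N] by eventually_elim blast
    then show ?case using null_setsD2[OF N] by blast
  qed
  have S: "interior S \<union> ?N = S" using interior_subset by auto
  have i: "interior S \<in> sets borel" by simp
  then have il: "interior S \<in> sets lebesgue" by (simp add: sets_completionI_sets)
  have "emeasure (gaussian_measure TYPE('n)) (interior S \<union> ?N) = emeasure (gaussian_measure TYPE('n)) (interior S)"
    using il by (intro emeasure_Un_null_set N') simp
  then have "emeasure (gaussian_measure TYPE('n)) S = emeasure (gaussian_measure TYPE('n)) (interior S)"
    by (simp only: S)
  then show "measure (gaussian_measure TYPE('n)) S = gauss_const TYPE('n) * gauss_vol (interior S)"
    using measure_gaussian_borel[OF i] by (simp add: measure_def)
qed

text \<open>Continuity from below of the measure with the unnormalized Gaussian density; this
  removes boundedness.\<close>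

lemma gauss_vol_Int_ball_tendsto:
  fixes S :: "'a::euclidean_space set"
  assumes "open S"
  shows "(\<lambda>k. gauss_vol (S \<inter> ball 0 (real k))) \<longlonglongrightarrow> gauss_vol S"
proof -
  define N :: "'a measure" where "N = density lborel (\<lambda>x. ennreal (exp (- (norm x)\<^sup>2 / 2)))"
  have e: "emeasure N T = gauss_mass T" if "T \<in> sets borel" for T
    unfolding N_def gauss_mass_def using that by (intro emeasure_density) auto
  have "(\<lambda>k. emeasure N (S \<inter> ball 0 (real k))) \<longlonglongrightarrow> emeasure N (\<Union>k. S \<inter> ball 0 (real k))"
    by (rule Lim_emeasure_incseq) (use assms in \<open>auto simp: incseq_def N_def\<close>)
  moreover have "(\<Union>k. S \<inter> ball 0 (real k)) = S"
    by (auto intro: reals_Archimedean2)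
  ultimately have "(\<lambda>k. gauss_mass (S \<inter> ball 0 (real k))) \<longlonglongrightarrow> gauss_mass S"
    using assms by (simp add: e borel_open open_Int)
  then show ?thesis
    by (simp add: gauss_mass_eq_gauss_vol gauss_vol_nonneg)
qed

section \<open>From bounded open sets to arbitrary symmetric convex sets\<close>

lemma zero_in_symmetric_convex:
  fixes S :: "'a::real_vector set"
  assumes "convex S" "S \<noteq> {}" "\<And>x. x \<in> S \<Longrightarrow> - x \<in> S"
  shows "0 \<in> S"
proof -
  obtain x where "x \<in> S" using assms by auto
  then have "(1/2) *\<^sub>R x + (1/2) *\<^sub>R (- x) \<in> S" using assms by (intro convexD) auto
  then show ?thesis by simp
qed

text \<open>Both sets contain 0, hence a common ball. Their intersections with balls of radius
  \<open>k\<close> satisfy the bounded case, their combination lies in the full one, and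
  \<open>k\<close> tends to infinity.\<close>

lemma gauss_vol_comb:
  fixes K L :: "'a::euclidean_space set"
  assumes cv: "convex K" "convex L" and op: "open K" "open L" and ne: "K \<noteq> {}" "L \<noteq> {}"
    and sym: "\<And>x. x \<in> K \<Longrightarrow> - x \<in> K" "\<And>x. x \<in> L \<Longrightarrow> - x \<in> L"
    and t: "0 \<le> t" "t \<le> 1"
  shows "(t * root DIM('a) (gauss_vol K) + (1 - t) * root DIM('a) (gauss_vol L)) ^ DIM('a) \<le> gauss_vol (set_comb t K L)"
proof -
  have "0 \<in> K \<inter> L" using zero_in_symmetric_convex[OF cv(1) ne(1) sym(1)] zero_in_symmetric_convex[OF cv(2) ne(2) sym(2)] by blast
  then obtain r where r: "0 < r" "ball 0 r \<subseteq> K \<inter> L"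
    using op openE[of "K \<inter> L" 0] by blast
  define N where "N k S = S \<inter> ball 0 (real k)" for k and S :: "'a set"
  have lim: "(\<lambda>k. (t * root DIM('a) (gauss_vol (N k K)) + (1 - t) * root DIM('a) (gauss_vol (N k L))) ^ DIM('a))
    \<longlonglongrightarrow> (t * root DIM('a) (gauss_vol K) + (1 - t) * root DIM('a) (gauss_vol L)) ^ DIM('a)"
    unfolding N_def by (intro tendsto_intros gauss_vol_Int_ball_tendsto op)
  show ?thesis
  proof (rule LIMSEQ_le_const2[OF lim], intro exI allI impI)
    fix k :: nat assume k: "1 \<le> k"
    define r' where "r' = min r (real k)"
    have r': "0 < r'" "ball 0 r' \<subseteq> N k K" "ball 0 r' \<subseteq> N k L"
      using r k by (auto simp: r'_def N_def)
    have opN: "open (N k K)" "open (N k L)" using op by (auto simp: N_def)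
    have "0 \<in> N k K" "0 \<in> N k L" using r' centre_in_ball[of 0 r'] by blast+
    then have pos: "0 < gauss_vol (N k K)" "0 < gauss_vol (N k L)"
      using opN gauss_vol_pos by blast+
    have "(t * root DIM('a) (gauss_vol (N k K)) + (1 - t) * root DIM('a) (gauss_vol (N k L))) ^ DIM('a)
        \<le> gauss_vol (set_comb t (N k K) (N k L))"
    proof (rule gauss_vol_comb_open[where r = r' and R = "real k"])
      show "convex (N k K)" "convex (N k L)" using cv by (auto simp: N_def convex_Int)
      show "norm x \<le> real k" if "x \<in> N k K" for x using that by (simp add: N_def)
      show "norm x \<le> real k" if "x \<in> N k L" for x using that by (simp add: N_def)
      show "- x \<in> N k K" if "x \<in> N k K" for x using that sym by (simp add: N_def)
      show "- x \<in> N k L" if "x \<in> N k L" for x using that sym by (simp add: N_def)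
      show "0 < root DIM('a) (gauss_vol (N k K))" "0 < root DIM('a) (gauss_vol (N k L))"
        using pos by simp_all
      show "root DIM('a) (gauss_vol (N k K)) ^ DIM('a) = gauss_vol (N k K)" "root DIM('a) (gauss_vol (N k L)) ^ DIM('a) = gauss_vol (N k L)"
        using pos by simp_all
    qed (use k in \<open>simp_all add: opN r' t\<close>)
    also have "\<dots> \<le> gauss_vol (set_comb t K L)"
      unfolding set_comb_def N_def by (rule gauss_vol_mono) blast
    finally show "(t * root DIM('a) (gauss_vol (N k K)) + (1 - t) * root DIM('a) (gauss_vol (N k L))) ^ DIM('a)
        \<le> gauss_vol (set_comb t K L)" .
  qed
qed

theorem theorem1p1:
  fixes K L :: "(real^'n) set" and t :: real
  assumes "convex K" "convex L" "origin_symmetric K" "origin_symmetric L"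
    and "K \<noteq> {}" "L \<noteq> {}"
    and "0 < t" "t < 1"
  shows "measure (gaussian_measure TYPE('n)) (minkowski_comb t K L) powr (1 / real CARD('n))
     \<ge> t * measure (gaussian_measure TYPE('n)) K powr (1 / real CARD('n))
       + (1 - t) * measure (gaussian_measure TYPE('n)) L powr (1 / real CARD('n))"
proof -
  let ?n = "CARD('n)" and ?c = "gauss_const TYPE('n)"
  \<comment> \<open>At 0 both sides are 0, since \<open>0 powr y = 0\<close>.\<close>
  have powr_root: "x powr (1 / real ?n) = root ?n x" if "0 \<le> x" for x :: real
    using that by (cases "x = 0") (auto simp: root_powr_inverse)
  have c: "0 < ?c" by (rule gauss_const_pos)
  have sym: "- x \<in> S" if "origin_symmetric S" "x \<in> S" for x :: "real^'n" and S
    using that unfolding origin_symmetric_def by blast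
  have symi: "- x \<in> interior S" if "origin_symmetric S" "x \<in> interior S" for x :: "real^'n" and S
    using that interior_negations[of S] unfolding origin_symmetric_def by (metis imageI)
  have zKL: "0 \<in> K" "0 \<in> L" using assms sym zero_in_symmetric_convex by blast+
  have cvc: "convex (set_comb t K L)" using assms by (intro convex_comb) auto
  have *: "(t * root ?n (gauss_vol (interior K)) + (1 - t) * root ?n (gauss_vol (interior L))) ^ ?n \<le> gauss_vol (interior (set_comb t K L))"
  proof (cases "interior K = {} \<or> interior L = {}")
    case False
    have "(t * root DIM(real^'n) (gauss_vol (interior K)) + (1 - t) * root DIM(real^'n) (gauss_vol (interior L))) ^ DIM(real^'n)
        \<le> gauss_vol (set_comb t (interior K) (interior L))"
      using False assms symi by (intro gauss_vol_comb) (auto simp: convex_interior)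
    also have "\<dots> \<le> gauss_vol (interior (set_comb t K L))"
    proof (intro gauss_vol_mono interior_maximal)
      show "set_comb t (interior K) (interior L) \<subseteq> set_comb t K L"
        using interior_subset unfolding set_comb_def by blast
      show "open (set_comb t (interior K) (interior L))" using False by (intro open_comb) auto
    qed
    finally show ?thesis by simp
  next
    case True
    \<comment> \<open>If one interior is empty, its term vanishes. Since 0 lies in both sets, the
      combination contains \<open>t K\<close> and \<open>(1 - t) L\<close>, and shrinking the other
      set suffices.\<close>
    have scale: "s ^ ?n * gauss_vol (interior S) \<le> gauss_vol (interior (set_comb t K L))"
      if "0 < s" "s < 1" "\<And>x. x \<in> S \<Longrightarrow> s *\<^sub>R x \<in> set_comb t K L" for s and S :: "(real^'n) set"
    proof -
      have "(\<lambda>x. s *\<^sub>R x) ` interior S \<subseteq> interior (set_comb t K L)"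
        using that interior_subset[of S] by (intro interior_maximal open_scaling) auto
      then have "s ^ DIM(real^'n) * gauss_vol (interior S) \<le> gauss_vol (interior (set_comb t K L))"
        using that by (intro gauss_vol_scale) auto
      then show ?thesis by simp
    qed
    have gauss_vol_empty: "gauss_vol ({} :: (real^'n) set) = 0" by (simp add: gauss_vol_def gauss_mass_def)
    have "(1 - t) *\<^sub>R x \<in> set_comb t K L" if "x \<in> L" for x
      using that zKL unfolding set_comb_def by force
    moreover have "t *\<^sub>R x \<in> set_comb t K L" if "x \<in> K" for x
      using that zKL unfolding set_comb_def by force
    ultimately show ?thesis
      using True scale[of t K] scale[of "1 - t" L] assms
      by (auto simp: gauss_vol_empty power_mult_distrib gauss_vol_nonneg)
  qed
  have "t * root ?n (gauss_vol (interior K)) + (1 - t) * root ?n (gauss_vol (interior L)) \<le> root ?n (gauss_vol (interior (set_comb t K L)))"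
  proof -
    have "0 \<le> t * root ?n (gauss_vol (interior K)) + (1 - t) * root ?n (gauss_vol (interior L))"
      using assms by (simp add: gauss_vol_nonneg)
    then show ?thesis using real_root_le_mono[OF _ *, of ?n] by (simp add: real_root_power_cancel)
  qed
  then have "root ?n ?c * (t * root ?n (gauss_vol (interior K)) + (1 - t) * root ?n (gauss_vol (interior L)))
      \<le> root ?n ?c * root ?n (gauss_vol (interior (set_comb t K L)))"
    using c by (intro mult_left_mono) auto
  \<comment> \<open>The root of the normalizing constant is a factor common to all three
    terms.\<close>
  moreover have "measure (gaussian_measure TYPE('n)) S powr (1 / real ?n) = root ?n ?c * root ?n (gauss_vol (interior S))"
    if "convex S" for S :: "(real^'n) set"
    unfolding measure_gaussian_convex[OF that] using c by (simp add: powr_root gauss_vol_nonneg real_root_mult)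
  ultimately show ?thesis
    using assms(1,2) cvc unfolding minkowski_comb_eq by (simp add: distrib_left mult.left_commute)
qed

end
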